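(* Let $M$ be a simple matroid with an element $x$ such that $\mathrm{si}(M/x)\cong M(K_n)$ for some $n\ge 4$, and each parallel class of $M/x$ has size $t\ge 2$. If there is no element $e\in E(M)$ for which $M/e$ has a $U_{2,t+2}$-restriction, then there is a group $\Gamma$ such that $M\cong \mathrm{LG}^+(n,\Gamma)$.
   Context: $\mathrm{si}(N)$ denotes the simplification of $N$; $M(K_n)$ the cycle matroid of the complete graph; $U_{2,b}$ the rank-2 uniform matroid on $b$ elements. For a finite group $\Gamma$ with $|\Gamma|\ge2$ and $k\ge3$: let $G$ be the loopless graph on $k$ vertices with exactly $|\Gamma|$ parallel edges between each pair of distinct vertices, edges between a given pair having the same orientation and labeled by the distinct elements of $\Gamma$ via $\phi$. A cycle is balanced if some simple closed walk around it with edges $e_1,\dots,e_m$ has $\prod_i\phi(e_i)^{\epsilon_i}=1$ ($\epsilon_i=\pm1$ for forward/backward traversal). $\mathrm{LG}(k,\Gamma)$ is the matroid on $E(G)$ whose circuits are: balanced cycles; two vertex-disjoint unbalanced cycles; two unbalanced cycles sharing exactly one vertex; theta subgraphs all of whose cycles are unbalanced. $\mathrm{LG}^+(k,\Gamma)$ is the extension of $\mathrm{LG}(k,\Gamma)$ by a new element $e_0$ with $\mathrm{LG}^+(k,\Gamma)\backslash e_0=\mathrm{LG}(k,\Gamma)$ and $\mathrm{LG}^+(k,\Gamma)/e_0$ equal to the cycle matroid of $G$. *)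

theory Defs
  imports "HOL-Algebra.Coset" "Graph_Theory.Arc_Walk"
begin

section \<open>Matroids\<close>

text \<open>
  A matroid is represented by its ground set and its family of independent sets.  The record
  carries raw data; the axioms (and finiteness) are imposed by the locale.
\<close>

record 'a indep_structure =
  ground :: "'a set"
  indeps :: "'a set set"

locale matroid =
  fixes M :: "'a indep_structure"
  assumes finite_ground: "finite (ground M)"
    and indeps_subset: "indeps M \<subseteq> Pow (ground M)"
    and indeps_empty: "{} \<in> indeps M"
    and indeps_down: "I \<in> indeps M \<Longrightarrow> J \<subseteq> I \<Longrightarrow> J \<in> indeps M"
    and indeps_augment: "I \<in> indeps M \<Longrightarrow> J \<in> indeps M \<Longrightarrow> card I < card J \<Longrightarrow>
      \<exists>e\<in>J - I. insert e I \<in> indeps M"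

definition matroid_iso :: "'a indep_structure \<Rightarrow> 'b indep_structure \<Rightarrow> bool" where
  "matroid_iso M N \<longleftrightarrow> (\<exists>f. bij_betw f (ground M) (ground N) \<and>
     (\<forall>X. X \<subseteq> ground M \<longrightarrow> (X \<in> indeps M \<longleftrightarrow> f ` X \<in> indeps N)))"

definition circuits :: "'a indep_structure \<Rightarrow> 'a set set" where
  "circuits M = {C. C \<subseteq> ground M \<and> C \<notin> indeps M \<and> (\<forall>D. D \<subset> C \<longrightarrow> D \<in> indeps M)}"

definition matroid_of_circuits :: "'a set \<Rightarrow> 'a set set \<Rightarrow> 'a indep_structure" where
  "matroid_of_circuits E \<C> = \<lparr>ground = E, indeps = {I. I \<subseteq> E \<and> \<not> (\<exists>C\<in>\<C>. C \<subseteq> I)}\<rparr>"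

definition restriction :: "'a indep_structure \<Rightarrow> 'a set \<Rightarrow> 'a indep_structure" where
  "restriction M X = \<lparr>ground = ground M \<inter> X, indeps = {I \<in> indeps M. I \<subseteq> X}\<rparr>"

definition deletion :: "'a indep_structure \<Rightarrow> 'a set \<Rightarrow> 'a indep_structure" where
  "deletion M T = restriction M (ground M - T)"

definition basis_of :: "'a indep_structure \<Rightarrow> 'a set \<Rightarrow> 'a set \<Rightarrow> bool" where
  "basis_of M T B \<longleftrightarrow> B \<in> indeps M \<and> B \<subseteq> T \<and>
     (\<forall>B'. B' \<in> indeps M \<longrightarrow> B \<subseteq> B' \<longrightarrow> B' \<subseteq> T \<longrightarrow> B' = B)"

text \<open>
  The independent sets of \<open>M / T\<close> are those disjoint from \<open>T\<close> whose union with a basis of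
  \<open>T\<close> is independent; in a matroid the choice of the basis is immaterial.
\<close>

definition contraction :: "'a indep_structure \<Rightarrow> 'a set \<Rightarrow> 'a indep_structure" where
  "contraction M T = \<lparr>ground = ground M - T,
     indeps = {I. I \<subseteq> ground M - T \<and> (\<exists>B. basis_of M T B \<and> I \<union> B \<in> indeps M)}\<rparr>"

definition loops :: "'a indep_structure \<Rightarrow> 'a set" where
  "loops M = {e \<in> ground M. {e} \<in> circuits M}"

definition parallel :: "'a indep_structure \<Rightarrow> 'a \<Rightarrow> 'a \<Rightarrow> bool" where
  "parallel M e f \<longleftrightarrow> e \<noteq> f \<and> {e, f} \<in> circuits M"

definition simple_matroid :: "'a indep_structure \<Rightarrow> bool" where
  "simple_matroid M \<longleftrightarrow> matroid M \<and> loops M = {} \<and> (\<forall>e f. \<not> parallel M e f)"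

definition parallel_rel :: "'a indep_structure \<Rightarrow> ('a \<times> 'a) set" where
  "parallel_rel M = {(e, f). e \<in> ground M - loops M \<and> f \<in> ground M - loops M \<and>
     (e = f \<or> parallel M e f)}"

definition parallel_classes :: "'a indep_structure \<Rightarrow> 'a set set" where
  "parallel_classes M = (ground M - loops M) // parallel_rel M"

text \<open>
  Delete all loops and all but one element of every parallel class.  Up to isomorphism the
  result does not depend on which representatives are kept.
\<close>

definition si :: "'a indep_structure \<Rightarrow> 'a indep_structure" where
  "si M = restriction M ((\<lambda>P. SOME e. e \<in> P) ` parallel_classes M)"

definition uniform :: "nat \<Rightarrow> nat \<Rightarrow> nat indep_structure" where
  "uniform r b = \<lparr>ground = {..<b}, indeps = {I. I \<subseteq> {..<b} \<and> card I \<le> r}\<rparr>"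

definition has_restriction :: "'a indep_structure \<Rightarrow> 'b indep_structure \<Rightarrow> bool" where
  "has_restriction M N \<longleftrightarrow> (\<exists>X \<subseteq> ground M. matroid_iso (restriction M X) N)"


section \<open>Cycles and thetas in oriented multigraphs\<close>

text \<open>
  A multigraph with a reference orientation of its edges is a \<open>pre_digraph\<close> with one arc per
  edge.  An arc of \<open>bidir G\<close> is an edge of \<open>G\<close> together with a direction of traversal
  (\<open>True\<close> = forward), so walks in the underlying undirected graph of \<open>G\<close> are exactly the
  directed walks in \<open>bidir G\<close>.
\<close>

definition bidir :: "('v, 'e) pre_digraph \<Rightarrow> ('v, 'e \<times> bool) pre_digraph" where
  "bidir G = \<lparr>verts = verts G, arcs = arcs G \<times> UNIV,
     tail = (\<lambda>(e, d). if d then tail G e else head G e),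
     head = (\<lambda>(e, d). if d then head G e else tail G e)\<rparr>"

definition edges_of :: "('e \<times> bool) list \<Rightarrow> 'e set" where
  "edges_of p = fst ` set p"

text \<open>
  Edges must not be repeated: \<open>pre_digraph.cycle (bidir G)\<close> alone would admit walking along
  an edge and straight back.
\<close>

definition simple_closed_walk :: "('v, 'e) pre_digraph \<Rightarrow> ('e \<times> bool) list \<Rightarrow> bool" where
  "simple_closed_walk G p \<longleftrightarrow> pre_digraph.cycle (bidir G) p \<and> distinct (map fst p)"

definition cycles :: "('v, 'e) pre_digraph \<Rightarrow> 'e set set" where
  "cycles G = {edges_of p | p. simple_closed_walk G p}"

definition ends :: "('v, 'e) pre_digraph \<Rightarrow> 'e set \<Rightarrow> 'v set" where
  "ends G X = tail G ` X \<union> head G ` X"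

text \<open>
  A theta consists of two distinct vertices and three paths joining them that pairwise share no
  edges and no vertices other than their ends.
\<close>

definition thetas :: "('v, 'e) pre_digraph \<Rightarrow> 'e set set" where
  "thetas G = {edges_of p \<union> edges_of q \<union> edges_of r | u v p q r. u \<noteq> v \<and>
     (\<forall>w\<in>{p, q, r}. pre_digraph.apath (bidir G) u w v) \<and>
     disjnt (edges_of p) (edges_of q) \<and> disjnt (edges_of p) (edges_of r) \<and>
     disjnt (edges_of q) (edges_of r) \<and>
     ends G (edges_of p) \<inter> ends G (edges_of q) = {u, v} \<and>
     ends G (edges_of p) \<inter> ends G (edges_of r) = {u, v} \<and>
     ends G (edges_of q) \<inter> ends G (edges_of r) = {u, v}}"

definition cycle_matroid :: "('v, 'e) pre_digraph \<Rightarrow> 'e indep_structure" where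
  "cycle_matroid G = matroid_of_circuits (arcs G) (cycles G)"

definition complete_graph :: "nat \<Rightarrow> (nat, nat \<times> nat) pre_digraph" where
  "complete_graph n = \<lparr>verts = {..<n}, arcs = {(i, j). i < j \<and> j < n}, tail = fst, head = snd\<rparr>"


section \<open>Group-labelled graphs and their lift matroids\<close>

definition walk_label :: "('g, 'm) monoid_scheme \<Rightarrow> ('e \<Rightarrow> 'g) \<Rightarrow> ('e \<times> bool) list \<Rightarrow> 'g" where
  "walk_label \<Gamma> \<phi> p =
     foldr (\<lambda>x y. x \<otimes>\<^bsub>\<Gamma>\<^esub> y) (map (\<lambda>(e, d). if d then \<phi> e else inv\<^bsub>\<Gamma>\<^esub> (\<phi> e)) p) \<one>\<^bsub>\<Gamma>\<^esub>"

definition balanced_cycles ::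
  "('g, 'm) monoid_scheme \<Rightarrow> ('e \<Rightarrow> 'g) \<Rightarrow> ('v, 'e) pre_digraph \<Rightarrow> 'e set set" where
  "balanced_cycles \<Gamma> \<phi> G =
     {edges_of p | p. simple_closed_walk G p \<and> walk_label \<Gamma> \<phi> p = \<one>\<^bsub>\<Gamma>\<^esub>}"

definition unbalanced_cycles ::
  "('g, 'm) monoid_scheme \<Rightarrow> ('e \<Rightarrow> 'g) \<Rightarrow> ('v, 'e) pre_digraph \<Rightarrow> 'e set set" where
  "unbalanced_cycles \<Gamma> \<phi> G = cycles G - balanced_cycles \<Gamma> \<phi> G"

definition lift_circuits ::
  "('g, 'm) monoid_scheme \<Rightarrow> ('e \<Rightarrow> 'g) \<Rightarrow> ('v, 'e) pre_digraph \<Rightarrow> 'e set set" where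
  "lift_circuits \<Gamma> \<phi> G =
     balanced_cycles \<Gamma> \<phi> G
     \<union> {C \<union> D | C D. C \<in> unbalanced_cycles \<Gamma> \<phi> G \<and> D \<in> unbalanced_cycles \<Gamma> \<phi> G \<and>
          ends G C \<inter> ends G D = {}}
     \<union> {C \<union> D | C D. C \<in> unbalanced_cycles \<Gamma> \<phi> G \<and> D \<in> unbalanced_cycles \<Gamma> \<phi> G \<and>
          (\<exists>v. ends G C \<inter> ends G D = {v})}
     \<union> {X \<in> thetas G. \<forall>C\<in>cycles G. C \<subseteq> X \<longrightarrow> C \<in> unbalanced_cycles \<Gamma> \<phi> G}"

text \<open>
  The edge \<open>(i, j, g)\<close>, for \<open>i < j\<close>, joins \<open>i\<close> to \<open>j\<close>, is oriented from \<open>i\<close> to \<open>j\<close>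
  and has label \<open>g\<close>.  Reversing the common orientation of the edges between two vertices only
  replaces their labels by the inverses, so fixing the orientation is no loss of generality.
\<close>

definition LG_graph :: "nat \<Rightarrow> ('g, 'm) monoid_scheme \<Rightarrow> (nat, nat \<times> nat \<times> 'g) pre_digraph" where
  "LG_graph k \<Gamma> = \<lparr>verts = {..<k}, arcs = {(i, j, g). i < j \<and> j < k \<and> g \<in> carrier \<Gamma>},
     tail = (\<lambda>(i, j, g). i), head = (\<lambda>(i, j, g). j)\<rparr>"

definition LG_label :: "nat \<times> nat \<times> 'g \<Rightarrow> 'g" where
  "LG_label = (\<lambda>(i, j, g). g)"

definition LG :: "nat \<Rightarrow> ('g, 'm) monoid_scheme \<Rightarrow> (nat \<times> nat \<times> 'g) indep_structure" where
  "LG k \<Gamma> = matroid_of_circuits (arcs (LG_graph k \<Gamma>)) (lift_circuits \<Gamma> LG_label (LG_graph k \<Gamma>))"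

text \<open>
  \<open>is_LG_plus k \<Gamma> N\<close>: \<open>N\<close> is (a copy of) the extension of \<open>LG k \<Gamma>\<close> by a new element \<open>e\<^sub>0\<close>.
  The name of \<open>e\<^sub>0\<close> is irrelevant; it may be any triple that is not an edge (for instance one
  with \<open>i = j\<close>).  Once that name is fixed, \<open>N\<close> is unique for \<open>k \<ge> 3\<close> and nontrivial \<open>\<Gamma>\<close>:
  \<open>e\<^sub>0\<close> is not a loop, since otherwise \<open>LG k \<Gamma>\<close> would be the cycle matroid of the graph, and
  hence the independent sets with and without \<open>e\<^sub>0\<close> are prescribed.
\<close>

definition is_LG_plus ::
  "nat \<Rightarrow> ('g, 'm) monoid_scheme \<Rightarrow> (nat \<times> nat \<times> 'g) indep_structure \<Rightarrow> bool" where
  "is_LG_plus k \<Gamma> N \<longleftrightarrow> matroid N \<and>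
     (\<exists>e\<^sub>0. e\<^sub>0 \<notin> ground (LG k \<Gamma>) \<and> ground N = insert e\<^sub>0 (ground (LG k \<Gamma>)) \<and>
        deletion N {e\<^sub>0} = LG k \<Gamma> \<and>
        contraction N {e\<^sub>0} = cycle_matroid (LG_graph k \<Gamma>))"

end

theory Submission
  imports Defs
begin

text \<open>
  Write \<open>P\<^sub>i\<^sub>j\<close> for the parallel class of \<open>M / x\<close> over the edge \<open>ij\<close> of \<open>K\<^sub>n\<close>.  If \<open>a \<in> P\<^sub>i\<^sub>j\<close> and
  \<open>b \<in> P\<^sub>j\<^sub>k\<close> had no \<open>c \<in> P\<^sub>i\<^sub>k\<close> on their line, then \<open>{x, b} \<union> P\<^sub>i\<^sub>k\<close> would be a \<open>U\<^sub>2\<^sub>,\<^sub>t\<^sub>+\<^sub>2\<close>-restriction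
  of \<open>M / a\<close>; so any two elements over adjacent edges lie in a unique dependent ("balanced")
  triangle.  Dependent triangles are those that do not span \<open>x\<close>, hence if three triangles over a
  \<open>K\<^sub>4\<close> are dependent, so is the fourth.  After fixing a base element over each edge at vertex 0,
  the triangles at 0 define multiplications, which the \<open>K\<^sub>4\<close> condition forces to coincide and to be
  associative.  This yields a labelling of the elements by a group \<open>\<Gamma>\<close>.  Finally, a cycle has
  trivial label iff it does not span \<open>x\<close>, and a dependent edge set without a balanced cycle has
  two cycles and therefore contains one of the other lift circuits.
\<close>


section \<open>Closure in matroids\<close>

text \<open>Contracting \<open>x\<close> determines which sets are independent together with
  \<open>x\<close>; it leaves open which cycles span \<open>x\<close>. Triangles settle this for all
  cycles, because a path can be replaced, one triangle at a time, by a single edge in its closure.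
  Hence the few facts collected in \<open>lift_labelling\<close> already determine the matroid. The
  obstacle in finding labels is that a dependent triangle is an unordered set, without direction or
  identity. Direction is taken from the order of the vertices. Completing triangles at vertex 0
  makes 0 a left identity by definition, but the labels over the different edges at 0 must also be
  matched with each other. This is arranged outright only through vertex 1, and the condition on K4
  carries the right identity to the other vertices. Rank is never introduced: dependence is mostly a
  matter of finding a small spanning set. Cycles are handled through reachability, so that walks are
  needed mainly for labels and thetas.\<close>

context matroid
begin

lemma indep_ground: "I \<in> indeps M \<Longrightarrow> I \<subseteq> ground M"
  using indeps_subset by blast

lemma indep_finite: "I \<in> indeps M \<Longrightarrow> finite I"
  using indep_ground finite_ground finite_subset by blast

lemma indep_extend:
  assumes "I \<in> indeps M" "J \<in> indeps M" "card I \<le> card J"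
  obtains K where "K \<in> indeps M" "I \<subseteq> K" "K \<subseteq> I \<union> J" "card K = card J"
proof -
  have "\<exists>K. K \<in> indeps M \<and> I \<subseteq> K \<and> K \<subseteq> I \<union> J \<and> card K = card J"
    using assms
  proof (induction "card J - card I" arbitrary: I)
    case 0
    then show ?case by (intro exI[of _ I]) auto
  next
    case (Suc k)
    then have "card I < card J" by simp
    then obtain e where e: "e \<in> J - I" "insert e I \<in> indeps M"
      using indeps_augment Suc.prems by blast
    have "card (insert e I) = Suc (card I)"
      using e Suc.prems(1) indep_finite by simp
    moreover from this have "k = card J - card (insert e I)" "card (insert e I) \<le> card J"
      using Suc.hyps(2) \<open>card I < card J\<close> by simp_all
    ultimately obtain K where "K \<in> indeps M" "insert e I \<subseteq> K" "K \<subseteq> insert e I \<union> J" "card K = card J"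
      using Suc.hyps(1)[of "insert e I"] e(2) Suc.prems(2) by blast
    then show ?case using e(1) by blast
  qed
  then show thesis using that by blast
qed

text \<open>The usual closure, tested on one independent subset at a time. No basis of
  \<open>X\<close> has to be chosen, monotonicity is immediate, and \<open>X\<close> need not lie in
  the ground set.\<close>

definition cl :: "'a set \<Rightarrow> 'a set" where
  "cl X = {e \<in> ground M. \<exists>I \<in> indeps M. I \<subseteq> X \<and> (e \<in> I \<or> insert e I \<notin> indeps M)}"

lemma cl_mono: "X \<subseteq> Y \<Longrightarrow> cl X \<subseteq> cl Y"
  by (auto simp: cl_def)

lemma subset_cl: "X \<subseteq> ground M \<Longrightarrow> X \<subseteq> cl X"
proof
  fix e assume "X \<subseteq> ground M" "e \<in> X"
  then show "e \<in> cl X"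
    using indeps_empty unfolding cl_def by (cases "{e} \<in> indeps M") blast+
qed

lemma clI: "I \<in> indeps M \<Longrightarrow> I \<subseteq> X \<Longrightarrow> e \<in> ground M \<Longrightarrow> insert e I \<notin> indeps M \<Longrightarrow> e \<in> cl X"
  by (auto simp: cl_def)

text \<open>The bound is on cardinality, not inclusion: \<open>J\<close> is topped up from an
  independent subset of \<open>X\<close> of largest size.\<close>

lemma maximal_indep:
  assumes "X \<subseteq> ground M" "J \<in> indeps M" "J \<subseteq> X"
  obtains B where "B \<in> indeps M" "J \<subseteq> B" "B \<subseteq> X" "\<And>K. K \<in> indeps M \<Longrightarrow> K \<subseteq> X \<Longrightarrow> card K \<le> card B"
proof -
  let ?S = "{K \<in> indeps M. K \<subseteq> X}"
  have fin: "finite ?S"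
    using assms(1) finite_ground by (auto intro: finite_subset[of _ "Pow X"] dest: finite_subset)
  have "J \<in> ?S" using assms by simp
  then obtain B0 where B0: "B0 \<in> ?S" "card B0 = Max (card ` ?S)"
    by (metis (no_types, lifting) Max_in empty_iff fin finite_imageI imageE image_is_empty)
  have max: "card K \<le> card B0" if "K \<in> ?S" for K
    using that fin B0(2) by simp
  obtain B where "B \<in> indeps M" "J \<subseteq> B" "B \<subseteq> J \<union> B0" "card B = card B0"
    using indep_extend[of J B0] max[OF \<open>J \<in> ?S\<close>] B0 assms by blast
  moreover have "J \<union> B0 \<subseteq> X" using B0(1) assms(3) by simp
  ultimately show thesis using that[of B] max by (metis (mono_tags, lifting) mem_Collect_eq order_trans)
qed

text \<open>Closure does not raise the rank. An element \<open>e\<close> enlarging \<open>I\<close>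
  would lie outside \<open>X\<close>, yet some \<open>I'\<close> inside \<open>X\<close> rejects it;
  growing \<open>I'\<close> within \<open>I' \<union> insert e I\<close> must then avoid
  \<open>e\<close> and beats the maximum inside \<open>X\<close>.\<close>

lemma card_indep_cl_le:
  assumes "X \<subseteq> ground M" "I \<in> indeps M" "I \<subseteq> X"
    and max: "\<And>K. K \<in> indeps M \<Longrightarrow> K \<subseteq> X \<Longrightarrow> card K \<le> card I"
    and J: "J \<in> indeps M" "J \<subseteq> cl X"
  shows "card J \<le> card I"
proof (rule ccontr)
  assume "\<not> ?thesis"
  then obtain e where e: "e \<in> J - I" "insert e I \<in> indeps M"
    using indeps_augment[of I J] assms by force
  have card: "card (insert e I) = Suc (card I)"
    using e assms(2) indep_finite by simp
  have "e \<notin> X" using max[of "insert e I"] e card assms(3) by auto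
  obtain I' where I': "I' \<in> indeps M" "I' \<subseteq> X" "insert e I' \<notin> indeps M"
    using e J(2) \<open>e \<notin> X\<close> by (auto simp: cl_def)
  obtain K where K: "K \<in> indeps M" "I' \<subseteq> K" "K \<subseteq> I' \<union> insert e I" "card K = Suc (card I)"
    using indep_extend[of I' "insert e I"] I' e(2) card max[of I'] by auto
  have "e \<notin> K" using K I'(3) indeps_down[of K "insert e I'"] by blast
  then have "K \<subseteq> X" using K(3) I'(2) assms(3) by blast
  then show False using max[OF K(1)] K(4) by simp
qed

text \<open>The form in which rank is counted later: a smaller spanning set proves
  dependence.\<close>

lemma dependent_in_cl:
  assumes "Z \<subseteq> ground M" "X \<subseteq> cl Z" "card Z < card X"
  shows "X \<notin> indeps M"
proof
  assume X: "X \<in> indeps M"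
  obtain B where B: "B \<in> indeps M" "B \<subseteq> Z" "\<And>K. K \<in> indeps M \<Longrightarrow> K \<subseteq> Z \<Longrightarrow> card K \<le> card B"
    using maximal_indep[OF assms(1) indeps_empty empty_subsetI] by metis
  have "card X \<le> card B"
    using card_indep_cl_le[OF assms(1) B X assms(2)] by simp
  also have "\<dots> \<le> card Z"
    using B(2) assms(1) finite_ground by (meson card_mono finite_subset)
  finally show False using assms(3) by simp
qed

text \<open>If \<open>e\<close> escaped \<open>cl X\<close>, it would enlarge a maximum independent
  subset \<open>I\<close> of \<open>X\<close>. Growing a witness \<open>J\<close> for
  \<open>e\<close> to that size cannot use \<open>e\<close>, so the result is an independent subset
  of \<open>cl X\<close> that is too large.\<close>

lemma cl_cl:
  assumes "X \<subseteq> ground M" "Y \<subseteq> cl X"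
  shows "cl Y \<subseteq> cl X"
proof
  fix e assume "e \<in> cl Y"
  then obtain J where J: "J \<in> indeps M" "J \<subseteq> Y" "e \<in> J \<or> insert e J \<notin> indeps M" and e: "e \<in> ground M"
    by (auto simp: cl_def)
  obtain I where I: "I \<in> indeps M" "I \<subseteq> X" "\<And>K. K \<in> indeps M \<Longrightarrow> K \<subseteq> X \<Longrightarrow> card K \<le> card I"
    using maximal_indep[OF assms(1) indeps_empty empty_subsetI] by metis
  show "e \<in> cl X"
  proof (rule ccontr)
    assume e': "e \<notin> cl X"
    then have "\<not> (e \<in> I \<or> insert e I \<notin> indeps M)" using I(1,2) e unfolding cl_def by blast
    then have "e \<notin> I" "insert e I \<in> indeps M" by simp_all
    then have card: "card (insert e I) = Suc (card I)"
      using I(1) indep_finite by simp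
    have "J \<subseteq> cl X" "e \<notin> J" using J(2) assms(2) e' by blast+
    have "card J \<le> card I"
      using card_indep_cl_le[OF assms(1) I J(1) \<open>J \<subseteq> cl X\<close>] by simp
    then obtain K where K: "K \<in> indeps M" "J \<subseteq> K" "K \<subseteq> J \<union> insert e I" "card K = Suc (card I)"
      using indep_extend[OF J(1) \<open>insert e I \<in> indeps M\<close>] card by (metis le_SucI)
    have "e \<notin> K" using K J(3) \<open>e \<notin> J\<close> indeps_down[of K "insert e J"] by blast
    then have "K \<subseteq> cl X" using K(3) \<open>J \<subseteq> cl X\<close> I(2) subset_cl[OF assms(1)] by blast
    then show False using card_indep_cl_le[OF assms(1) I K(1)] K(4) by simp
  qed
qed

lemma in_cl_trans:
  "e \<in> cl Y \<Longrightarrow> Y \<subseteq> cl X \<Longrightarrow> X \<subseteq> ground M \<Longrightarrow> e \<in> cl X"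
  using cl_cl by blast

lemma cl_indep_iff:
  assumes "I \<in> indeps M" "e \<in> ground M"
  shows "e \<in> cl I \<longleftrightarrow> e \<in> I \<or> insert e I \<notin> indeps M"
proof
  assume "e \<in> cl I"
  then obtain J where J: "J \<subseteq> I" "e \<in> J \<or> insert e J \<notin> indeps M" by (auto simp: cl_def)
  then show "e \<in> I \<or> insert e I \<notin> indeps M" using indeps_down[of "insert e I" "insert e J"] by blast
qed (use assms in \<open>auto simp: cl_def\<close>)

lemma insert_indep:
  "I \<in> indeps M \<Longrightarrow> e \<in> ground M \<Longrightarrow> e \<notin> cl I \<Longrightarrow> insert e I \<in> indeps M"
  using cl_indep_iff by blast

lemma indep_insertD:
  "insert e I \<in> indeps M \<Longrightarrow> e \<notin> I \<Longrightarrow> e \<notin> cl I"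
  using cl_indep_iff[of I e] indeps_down[of "insert e I" I] indep_ground by blast

lemma not_in_cl:
  assumes "I \<in> indeps M" "insert e I \<in> indeps M" "e \<notin> I" "X \<subseteq> cl I"
  shows "e \<notin> cl X"
  using indep_insertD[OF assms(2,3)] cl_cl[OF indep_ground[OF assms(1)] assms(4)] by blast

lemma dependent_if_in_cl:
  assumes "e \<in> X" "e \<in> cl (X - {e})"
  shows "X \<notin> indeps M"
  using assms indep_insertD[of e "X - {e}"] by (auto simp: insert_absorb)

lemma cl_trans:
  assumes "e \<in> cl (insert f X)" "f \<in> cl X" "X \<subseteq> ground M"
  shows "e \<in> cl X"
  using cl_cl[of X "insert f X"] assms subset_cl by blast

section \<open>Simple matroids and contraction of one element\<close>

lemma simple_pair_indep:
  assumes "simple_matroid M" "e \<in> ground M" "f \<in> ground M"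
  shows "{e, f} \<in> indeps M"
proof -
  have single: "{e} \<in> indeps M" if "e \<in> ground M" for e
  proof (rule ccontr)
    assume "{e} \<notin> indeps M"
    moreover have "D = {}" if "D \<subset> {e}" for D using that by blast
    ultimately have "{e} \<in> circuits M" using that indeps_empty by (auto simp: circuits_def)
    then show False using assms(1) that by (auto simp: simple_matroid_def loops_def)
  qed
  show ?thesis
  proof (rule ccontr)
    assume dep: "{e, f} \<notin> indeps M"
    then have "e \<noteq> f" using single assms(2) by auto
    have "D \<in> indeps M" if "D \<subset> {e, f}" for D
    proof -
      have "D \<subseteq> {e} \<or> D \<subseteq> {f}" using that by blast
      then show ?thesis using single assms(2,3) indeps_down by blast
    qed
    then have "parallel M e f"
      using dep \<open>e \<noteq> f\<close> assms(2,3) by (auto simp: parallel_def circuits_def)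
    then show False using assms(1) by (simp add: simple_matroid_def)
  qed
qed

lemma contraction_indep_iff:
  assumes "{x} \<in> indeps M"
  shows "I \<in> indeps (contraction M {x}) \<longleftrightarrow> I \<subseteq> ground M - {x} \<and> insert x I \<in> indeps M"
proof -
  have "basis_of M {x} B \<longleftrightarrow> B = {x}" for B
    using assms unfolding basis_of_def by auto
  then show ?thesis by (simp add: contraction_def)
qed

lemma contraction_ground [simp]: "ground (contraction M T) = ground M - T"
  by (simp add: contraction_def)

text \<open>Since \<open>J\<close> lies in the closure of \<open>Z\<close>, a maximum independent
  subset of \<open>Z\<close> has at least \<open>card J\<close> elements and so exhausts
  \<open>Z\<close>. This is what allows parallel elements to be exchanged in
  \<open>indep_rep_iff\<close>.\<close>

lemma spanning_indep:
  assumes "J \<in> indeps M" "J \<subseteq> cl Z" "Z \<subseteq> ground M" "card Z \<le> card J"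
  shows "Z \<in> indeps M"
proof -
  have "finite Z" using assms(3) finite_ground finite_subset by blast
  from maximal_indep[OF assms(3) indeps_empty empty_subsetI]
  obtain B where B: "B \<in> indeps M" "B \<subseteq> Z" "\<And>K. K \<in> indeps M \<Longrightarrow> K \<subseteq> Z \<Longrightarrow> card K \<le> card B"
    by metis
  have "card Z \<le> card B"
    using card_indep_cl_le[OF assms(3) B assms(1,2)] assms(4) by simp
  then have "B = Z" using B(2) \<open>finite Z\<close> by (simp add: card_seteq)
  then show ?thesis using B(1) by simp
qed

end

text \<open>\<open>is_LG_plus\<close> asks for deletion and contraction to be equal to given
  structures on triples, not merely isomorphic to them, so the matroid is pulled back to that ground
  set.\<close>

lemma (in matroid) transport:
  assumes \<psi>: "bij_betw \<psi> E (ground M)"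
    and N: "N = \<lparr>ground = E, indeps = {X. X \<subseteq> E \<and> \<psi> ` X \<in> indeps M}\<rparr>"
  shows "matroid N" "matroid_iso M N"
proof -
  have inj: "inj_on \<psi> E" and im: "\<psi> ` E = ground M"
    using \<psi> by (auto simp: bij_betw_def)
  show "matroid N"
  proof
    show "finite (ground N)" using \<psi> finite_ground N by (simp add: bij_betw_finite)
    show "indeps N \<subseteq> Pow (ground N)" "{} \<in> indeps N" using N indeps_empty by auto
    show "J \<in> indeps N" if "I \<in> indeps N" "J \<subseteq> I" for I J
      using that N indeps_down[of "\<psi> ` I" "\<psi> ` J"] by auto
    show "\<exists>e\<in>J - I. insert e I \<in> indeps N" if "I \<in> indeps N" "J \<in> indeps N" "card I < card J" for I J
    proof -
      have IJ: "I \<subseteq> E" "J \<subseteq> E" "\<psi> ` I \<in> indeps M" "\<psi> ` J \<in> indeps M" using that N by auto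
      have "card (\<psi> ` I) < card (\<psi> ` J)"
        using IJ that(3) inj by (simp add: card_image inj_on_subset)
      then obtain y where "y \<in> \<psi> ` J - \<psi> ` I" "insert y (\<psi> ` I) \<in> indeps M"
        using indeps_augment[OF IJ(3,4)] by blast
      then obtain e where "e \<in> J - I" "insert (\<psi> e) (\<psi> ` I) \<in> indeps M" by blast
      then show ?thesis using IJ N by (intro bexI[of _ e]) auto
    qed
  qed
  show "matroid_iso M N"
    unfolding matroid_iso_def
  proof (intro exI conjI allI impI)
    let ?f = "inv_into E \<psi>"
    show "bij_betw ?f (ground M) (ground N)" using \<psi> N by (simp add: bij_betw_inv_into)
    show "X \<in> indeps M \<longleftrightarrow> ?f ` X \<in> indeps N" if "X \<subseteq> ground M" for X
    proof -
      have "\<psi> ` ?f ` X = X" using that im by (simp add: image_inv_into_cancel)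
      moreover have "?f ` X \<subseteq> E" using that im by (auto simp: inv_into_into)
      ultimately show ?thesis using N by simp
    qed
  qed
qed

section \<open>Cycles and connectivity\<close>

definition adj_rel :: "('v, 'e) pre_digraph \<Rightarrow> 'e set \<Rightarrow> ('v \<times> 'v) set" where
  "adj_rel G Y = (\<Union>e\<in>Y. {(tail G e, head G e), (head G e, tail G e)})"

text \<open>Plain reachability does not care about repeated vertices or edges, which suits closure
  arguments; \<open>has_cycle_iff\<close> translates back to simple closed walks.\<close>

definition joined :: "('v, 'e) pre_digraph \<Rightarrow> 'e set \<Rightarrow> 'v \<Rightarrow> 'v \<Rightarrow> bool" where
  "joined G Y u v \<longleftrightarrow> (u, v) \<in> (adj_rel G Y)\<^sup>*"

lemma joined_mono: "joined G Y u v \<Longrightarrow> Y \<subseteq> Z \<Longrightarrow> joined G Z u v"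
  unfolding joined_def adj_rel_def by (erule rtrancl_mono[THEN subsetD, rotated]) blast

lemma joined_sym: "joined G Y u v \<Longrightarrow> joined G Y v u"
proof -
  have "sym (adj_rel G Y)" by (auto simp: sym_def adj_rel_def)
  then show "joined G Y u v \<Longrightarrow> joined G Y v u"
    unfolding joined_def by (meson sym_rtrancl symD)
qed

lemma joined_trans: "joined G Y u v \<Longrightarrow> joined G Y v w \<Longrightarrow> joined G Y u w"
  unfolding joined_def by (rule rtrancl_trans)

lemma joined_edge: "e \<in> Y \<Longrightarrow> joined G Y (tail G e) (head G e)"
  unfolding joined_def adj_rel_def by (rule r_into_rtrancl) blast

lemma not_joined_isolated:
  assumes "v \<notin> ends G Y" "joined G Y v w"
  shows "w = v"
proof -
  have "(v, y) \<notin> adj_rel G Y" for y using assms(1) by (auto simp: adj_rel_def ends_def)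
  then show ?thesis using assms(2) unfolding joined_def by (metis converse_rtranclE)
qed

lemma bidir_simps [simp]:
  "verts (bidir G) = verts G"
  "arcs (bidir G) = arcs G \<times> UNIV"
  "tail (bidir G) (e, d) = (if d then tail G e else head G e)"
  "head (bidir G) (e, d) = (if d then head G e else tail G e)"
  by (simp_all add: bidir_def)

lemma edges_of_simps [simp]:
  "edges_of [] = {}"
  "edges_of (a # p) = insert (fst a) (edges_of p)"
  "edges_of (p @ q) = edges_of p \<union> edges_of q"
  by (auto simp: edges_of_def)

lemma cas_append_ex:
  "pre_digraph.cas H u (p @ q) v \<longleftrightarrow> (\<exists>w. pre_digraph.cas H u p w \<and> pre_digraph.cas H w q v)"
  by (induction p arbitrary: u) (simp_all add: pre_digraph.cas.simps)

lemma cas_verts: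
  "pre_digraph.cas H u p v \<Longrightarrow> pre_digraph.awalk_verts H u p = map (tail H) p @ [v]"
  by (induction p arbitrary: u) (simp_all add: pre_digraph.cas.simps pre_digraph.awalk_verts.simps)

lemma cas_tails_heads:
  "pre_digraph.cas H u p v \<Longrightarrow> insert v (tail H ` set p) = insert u (head H ` set p)"
proof (induction p arbitrary: u)
  case (Cons a p)
  then have "insert v (tail H ` set p) = insert (head H a) (head H ` set p)" "tail H a = u"
    by (simp_all add: pre_digraph.cas.simps)
  then show ?case by auto
qed (simp add: pre_digraph.cas.simps)

lemma apath_iff:
  "pre_digraph.apath H u p v \<longleftrightarrow> u \<in> verts H \<and> set p \<subseteq> arcs H \<and> pre_digraph.cas H u p v \<and>
    distinct (map (tail H) p) \<and> v \<notin> tail H ` set p"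
  by (auto simp: pre_digraph.apath_def pre_digraph.awalk_def cas_verts)

lemma ends_edges_of: "ends G (edges_of p) = tail (bidir G) ` set p \<union> head (bidir G) ` set p"
proof (induction p)
  case (Cons a p)
  then show ?case by (cases a; cases "snd a") (auto simp: ends_def)
qed (simp add: ends_def)

lemma ends_walk:
  assumes "pre_digraph.cas (bidir G) u p v" "p \<noteq> []"
  shows "ends G (edges_of p) = insert v (tail (bidir G) ` set p)"
proof -
  obtain a p' where "p = a # p'" using assms(2) by (cases p) auto
  then have "u \<in> tail (bidir G) ` set p" using assms(1) by (auto simp: pre_digraph.cas.simps)
  then show ?thesis using cas_tails_heads[OF assms(1)] by (auto simp: ends_edges_of)
qed

lemma ends_closed_walk:
  assumes "pre_digraph.cas (bidir G) u p u"
  shows "ends G (edges_of p) = tail (bidir G) ` set p"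
proof (cases p)
  case (Cons a p')
  then have "u \<in> tail (bidir G) ` set p" using assms by (auto simp: pre_digraph.cas.simps)
  then show ?thesis using ends_walk[OF assms] Cons by auto
qed (simp add: ends_def)

context wf_digraph
begin

lemma wf_bidir: "wf_digraph (bidir G)"
  by unfold_locales auto

lemma simple_closed_walk_iff:
  "simple_closed_walk G p \<longleftrightarrow> p \<noteq> [] \<and> distinct (map fst p) \<and> set p \<subseteq> arcs (bidir G) \<and>
    distinct (map (tail (bidir G)) p) \<and> (\<exists>u. pre_digraph.cas (bidir G) u p u)"
proof -
  have *: "distinct (tl (pre_digraph.awalk_verts (bidir G) u p)) \<longleftrightarrow> distinct (map (tail (bidir G)) p)"
    if "pre_digraph.cas (bidir G) u p u" for u
    using that cas_verts[OF that] by (cases p) (auto simp: pre_digraph.cas.simps)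
  have "u \<in> verts G" if "pre_digraph.cas (bidir G) u p u" "set p \<subseteq> arcs (bidir G)" "p \<noteq> []" for u
    using that by (cases p) (auto simp: pre_digraph.cas.simps split: if_splits)
  then show ?thesis
    unfolding simple_closed_walk_def pre_digraph.cycle_def pre_digraph.awalk_def using * by auto
qed

lemma simple_closed_walk_rotate:
  assumes "simple_closed_walk G (p @ q)"
  shows "simple_closed_walk G (q @ p)"
  using assms unfolding simple_closed_walk_iff cas_append_ex by auto

text \<open>Simplicity of an \<open>apath\<close> concerns vertices. The start vertex is an end of
  the first edge and is never met again, so that edge cannot recur.\<close>

lemma apath_distinct_edges:
  "pre_digraph.apath (bidir G) u p v \<Longrightarrow> distinct (map fst p)"
proof (induction p arbitrary: u)
  case (Cons a p)
  let ?B = "bidir G"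
  obtain e d where a: "a = (e, d)" by fastforce
  have *: "pre_digraph.cas ?B (head ?B a) p v" "tail ?B a \<notin> insert v (tail ?B ` set p)"
    "distinct (map (tail ?B) p)" "v \<notin> tail ?B ` set p" "set p \<subseteq> arcs ?B" "a \<in> arcs ?B"
    using Cons.prems unfolding apath_iff by (auto simp: pre_digraph.cas.simps)
  have "head ?B a \<in> verts ?B" using *(6) a by auto
  then have "pre_digraph.apath ?B (head ?B a) p v" unfolding apath_iff using * by simp
  then have "distinct (map fst p)" by (rule Cons.IH)
  moreover have "tail ?B a \<notin> ends G (edges_of p)"
    using ends_walk[OF *(1)] *(2) by (cases "p = []") (auto simp: ends_def)
  then have "e \<notin> edges_of p"
    using a by (auto simp: ends_def split: if_splits)
  ultimately show ?case using a by (auto simp: edges_of_def)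
qed simp

lemma walk_joined:
  "pre_digraph.cas (bidir G) u p v \<Longrightarrow> joined G (edges_of p) u v"
proof (induction p arbitrary: u)
  case (Cons a p)
  obtain e d where a: "a = (e, d)" by fastforce
  have "joined G (edges_of (a # p)) u (head (bidir G) a)"
    using Cons.prems joined_edge[of e "edges_of (a # p)" G] joined_sym a
    by (auto simp: pre_digraph.cas.simps split: if_splits)
  moreover have "joined G (edges_of (a # p)) (head (bidir G) a) v"
    using Cons joined_mono[of G "edges_of p" _ v "edges_of (a # p)"]
    by (simp add: pre_digraph.cas.simps subset_insertI)
  ultimately show ?case by (rule joined_trans)
qed (simp add: pre_digraph.cas.simps joined_def)

lemma joined_walk:
  assumes "joined G Y u v" "Y \<subseteq> arcs G" "u \<in> verts G"
  shows "\<exists>p. pre_digraph.awalk (bidir G) u p v \<and> edges_of p \<subseteq> Y"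
  using assms(1) unfolding joined_def
proof (induction rule: rtrancl_induct)
  case base
  then show ?case using assms(3)
    by (intro exI[of _ "[]"]) (simp add: pre_digraph.awalk_def pre_digraph.cas.simps)
next
  case (step y z)
  interpret B: wf_digraph "bidir G" by (rule wf_bidir)
  obtain p where p: "B.awalk u p y" "edges_of p \<subseteq> Y" using step by blast
  obtain e where e: "e \<in> Y" "(y = tail G e \<and> z = head G e) \<or> (y = head G e \<and> z = tail G e)"
    using step(2) by (auto simp: adj_rel_def)
  then obtain d where "tail (bidir G) (e, d) = y" "head (bidir G) (e, d) = z"
    by (metis bidir_simps(3,4))
  then have "B.awalk y [(e, d)] z"
    using e(1) assms(2) by (auto simp: B.awalk_simps)
  then have "B.awalk u (p @ [(e, d)]) z" using p(1) B.awalk_appendI by blast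
  then show ?case using p(2) e(1) by (intro exI[of _ "p @ [(e, d)]"]) simp
qed

lemma joined_apath:
  assumes "joined G Y u v" "Y \<subseteq> arcs G" "u \<in> verts G"
  obtains p where "pre_digraph.apath (bidir G) u p v" "edges_of p \<subseteq> Y"
proof -
  interpret B: wf_digraph "bidir G" by (rule wf_bidir)
  obtain p where p: "B.awalk u p v" "edges_of p \<subseteq> Y" using joined_walk[OF assms] by blast
  have "edges_of (B.awalk_to_apath p) \<subseteq> edges_of p"
    using B.awalk_to_apath_subset[OF p(1)] by (auto simp: edges_of_def)
  then show thesis using that B.apath_awalk_to_apath[OF p(1)] p(2) by blast
qed

text \<open>After rotating the walk so that \<open>e\<close> comes first, the remainder joins its
  ends and avoids \<open>e\<close>.\<close>

lemma cycle_joined: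
  assumes "C \<in> cycles G" "e \<in> C"
  shows "C \<subseteq> arcs G" "joined G (C - {e}) (tail G e) (head G e)"
proof -
  let ?B = "bidir G"
  obtain p where p: "simple_closed_walk G p" "C = edges_of p"
    using assms(1) by (auto simp: cycles_def)
  then show "C \<subseteq> arcs G" by (auto simp: simple_closed_walk_iff edges_of_def)
  obtain d where "(e, d) \<in> set p" using assms(2) p(2) by (auto simp: edges_of_def)
  then obtain p1 p2 where "p = p1 @ (e, d) # p2" by (meson split_list)
  then have "simple_closed_walk G ((e, d) # p2 @ p1)"
    using p(1) simple_closed_walk_rotate[of p1 "(e, d) # p2"] by simp
  then have *: "pre_digraph.cas ?B (head ?B (e, d)) (p2 @ p1) (tail ?B (e, d))"
    "e \<notin> edges_of (p2 @ p1)"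
    unfolding simple_closed_walk_iff by (auto simp: pre_digraph.cas.simps edges_of_def)
  have "edges_of (p2 @ p1) \<subseteq> C - {e}"
    using *(2) p(2) \<open>p = p1 @ (e, d) # p2\<close> by auto
  then have "joined G (C - {e}) (head ?B (e, d)) (tail ?B (e, d))"
    by (rule joined_mono[OF walk_joined[OF *(1)]])
  from this joined_sym[OF this] show "joined G (C - {e}) (tail G e) (head G e)"
    by (cases d) simp_all
qed

lemma cycles_nonempty: "C \<in> cycles G \<Longrightarrow> C \<noteq> {}"
  unfolding cycles_def by (auto simp: simple_closed_walk_iff edges_of_def)

text \<open>A path that joins the ends of \<open>e\<close> without using \<open>e\<close> closes up
  to a cycle. It may be a single parallel edge, so digons count as cycles.\<close>

lemma has_cycle_iff:
  assumes "Y \<subseteq> arcs G"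
  shows "(\<exists>C\<in>cycles G. C \<subseteq> Y) \<longleftrightarrow> (\<exists>e\<in>Y. joined G (Y - {e}) (tail G e) (head G e))"
proof
  assume "\<exists>C\<in>cycles G. C \<subseteq> Y"
  then obtain C where C: "C \<in> cycles G" "C \<subseteq> Y" by blast
  then obtain e where "e \<in> C" using cycles_nonempty by blast
  then show "\<exists>e\<in>Y. joined G (Y - {e}) (tail G e) (head G e)"
    using cycle_joined(2)[OF C(1) \<open>e \<in> C\<close>] C(2) joined_mono[of G "C - {e}"] by blast
next
  let ?B = "bidir G"
  assume "\<exists>e\<in>Y. joined G (Y - {e}) (tail G e) (head G e)"
  then obtain e where e: "e \<in> Y" "joined G (Y - {e}) (head G e) (tail G e)"
    by (meson joined_sym)
  have "Y - {e} \<subseteq> arcs G" "head G e \<in> verts G" using assms e(1) by auto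
  from joined_apath[OF e(2) this]
  obtain p where p: "pre_digraph.apath ?B (head G e) p (tail G e)" "edges_of p \<subseteq> Y - {e}" .
  have "simple_closed_walk G ((e, True) # p)"
    using p apath_distinct_edges[OF p(1)] e(1) assms
    by (auto simp: simple_closed_walk_iff apath_iff pre_digraph.cas.simps edges_of_def)
  then have "edges_of ((e, True) # p) \<in> cycles G" unfolding cycles_def by blast
  then show "\<exists>C\<in>cycles G. C \<subseteq> Y"
    by (rule rev_bexI) (use p(2) e(1) in auto)
qed

text \<open>Every edge of a star ends in a leaf, which becomes isolated once the edge is
  removed.\<close>

lemma star_acyclic:
  assumes "Y \<subseteq> arcs G" "\<And>e. e \<in> Y \<Longrightarrow> tail G e \<noteq> head G e"
    and "\<And>e. e \<in> Y \<Longrightarrow> u \<in> {tail G e, head G e}"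
    and "\<And>e f. e \<in> Y \<Longrightarrow> f \<in> Y \<Longrightarrow> {tail G e, head G e} = {tail G f, head G f} \<Longrightarrow> e = f"
  shows "\<not> (\<exists>C\<in>cycles G. C \<subseteq> Y)"
proof
  assume "\<exists>C\<in>cycles G. C \<subseteq> Y"
  then obtain e where e: "e \<in> Y" "joined G (Y - {e}) (tail G e) (head G e)"
    using has_cycle_iff[OF assms(1)] by blast
  define v where "v = (if u = tail G e then head G e else tail G e)"
  have v: "{tail G e, head G e} = {u, v}" "u \<noteq> v"
    using assms(2,3)[OF e(1)] by (auto simp: v_def)
  have "v \<notin> ends G (Y - {e})"
  proof
    assume "v \<in> ends G (Y - {e})"
    then obtain f where f: "f \<in> Y" "f \<noteq> e" "v \<in> {tail G f, head G f}" by (auto simp: ends_def)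
    then have "{tail G f, head G f} = {u, v}" using assms(3)[OF f(1)] v(2) by auto
    then show False using assms(4)[OF f(1) e(1)] v(1) f(2) by simp
  qed
  moreover have "joined G (Y - {e}) v u"
    using e(2) joined_sym[OF e(2)] v by (auto simp: doubleton_eq_iff)
  ultimately show False using not_joined_isolated v(2) by metis
qed

end

section \<open>Splitting walks and finding a theta in two cycles\<close>

definition rev_walk :: "('e \<times> bool) list \<Rightarrow> ('e \<times> bool) list" where
  "rev_walk p = rev (map (\<lambda>(e, d). (e, \<not> d)) p)"

lemma edges_of_rev_walk [simp]: "edges_of (rev_walk p) = edges_of p"
  by (force simp: rev_walk_def edges_of_def)

lemma cas_rev_walk:
  "pre_digraph.cas (bidir G) u p v \<Longrightarrow> pre_digraph.cas (bidir G) v (rev_walk p) u"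
proof (induction p arbitrary: u)
  case (Cons a p)
  obtain e d where a: "a = (e, d)" by fastforce
  have "rev_walk (a # p) = rev_walk p @ [(e, \<not> d)]" by (simp add: rev_walk_def a)
  then show ?case using Cons a by (auto simp: cas_append_ex pre_digraph.cas.simps)
qed (simp add: rev_walk_def pre_digraph.cas.simps)

lemma (in wf_digraph) apath_rev_walk:
  assumes "pre_digraph.apath (bidir G) u p v"
  shows "pre_digraph.apath (bidir G) v (rev_walk p) u"
proof (cases "p = []")
  case True
  then show ?thesis using assms by (auto simp: apath_iff rev_walk_def pre_digraph.cas.simps)
next
  case False
  let ?B = "bidir G"
  interpret B: wf_digraph ?B by (rule wf_bidir)
  have "v \<in> verts G" using assms B.awalk_last_in_verts B.awalkI_apath by fastforce
  have c: "B.cas u p v" "B.cas v (rev_walk p) u"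
    using assms cas_rev_walk[of G u p v] unfolding apath_iff by simp_all
  have "map (tail ?B) (rev_walk p) = rev (map (head ?B) p)"
    by (simp add: rev_walk_def rev_map comp_def split_beta bidir_def)
  moreover have "distinct (u # map (head ?B) p)"
  proof -
    have "B.awalk_verts u p = u # map (head ?B) p"
      using B.awalk_verts_conv'[OF c(1)] False c(1) by (cases p) (auto simp: B.cas.simps)
    then show ?thesis using assms by (simp add: B.apath_def)
  qed
  moreover have "set (rev_walk p) \<subseteq> arcs ?B"
    using assms by (auto simp: rev_walk_def apath_iff)
  ultimately show ?thesis using c(2) \<open>v \<in> verts G\<close>
    unfolding apath_iff by (metis bidir_simps(1) distinct.simps(2) distinct_rev list.set_map set_rev)
qed

lemma cas_first_hit:
  assumes "pre_digraph.cas H u p v" "\<exists>w\<in>insert v (tail H ` set p). w \<in> V"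
  obtains p1 p2 w where "p = p1 @ p2" "pre_digraph.cas H u p1 w" "pre_digraph.cas H w p2 v"
    "w \<in> V" "tail H ` set p1 \<inter> V = {}"
proof -
  have "\<exists>p1 p2 w. p = p1 @ p2 \<and> pre_digraph.cas H u p1 w \<and> pre_digraph.cas H w p2 v \<and>
    w \<in> V \<and> tail H ` set p1 \<inter> V = {}"
    using assms
  proof (induction p arbitrary: u)
    case Nil
    then show ?case by (intro exI[of _ "[]"]) (auto simp: pre_digraph.cas.simps)
  next
    case (Cons a p)
    show ?case
    proof (cases "u \<in> V")
      case True
      then show ?thesis using Cons.prems
        by (intro exI[of _ "[]"] exI[of _ "a # p"] exI[of _ u]) (auto simp: pre_digraph.cas.simps)
    next
      case False
      have "tail H a = u" "pre_digraph.cas H (head H a) p v"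
        using Cons.prems by (auto simp: pre_digraph.cas.simps)
      then obtain p1 p2 w where "p = p1 @ p2" "pre_digraph.cas H (head H a) p1 w"
        "pre_digraph.cas H w p2 v" "w \<in> V" "tail H ` set p1 \<inter> V = {}"
        using Cons.IH[of "head H a"] Cons.prems(2) False by auto
      then show ?thesis using False \<open>tail H a = u\<close>
        by (intro exI[of _ "a # p1"] exI[of _ p2] exI[of _ w]) (auto simp: pre_digraph.cas.simps)
    qed
  qed
  then show thesis using that by blast
qed

lemma cas_last_hit:
  assumes "pre_digraph.cas H u p v" "u \<in> V"
  obtains p1 p2 w where "p = p1 @ p2" "pre_digraph.cas H u p1 w" "pre_digraph.cas H w p2 v"
    "w \<in> V" "head H ` set p2 \<inter> V = {}"
proof -
  have "\<exists>p1 p2 w. p = p1 @ p2 \<and> pre_digraph.cas H u p1 w \<and> pre_digraph.cas H w p2 v \<and>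
    w \<in> V \<and> head H ` set p2 \<inter> V = {}"
    using assms
  proof (induction p arbitrary: v rule: rev_induct)
    case Nil
    then show ?case by (intro exI[of _ "[]"]) (auto simp: pre_digraph.cas.simps)
  next
    case (snoc a p)
    show ?case
    proof (cases "v \<in> V")
      case True
      then show ?thesis using snoc.prems
        by (intro exI[of _ "p @ [a]"] exI[of _ "[]"] exI[of _ v]) (auto simp: pre_digraph.cas.simps)
    next
      case False
      have v: "head H a = v" "pre_digraph.cas H u p (tail H a)"
        using snoc.prems by (auto simp: pre_digraph.cas.simps cas_append_ex)
      then obtain p1 p2 w where "p = p1 @ p2" "pre_digraph.cas H u p1 w"
        "pre_digraph.cas H w p2 (tail H a)" "w \<in> V" "head H ` set p2 \<inter> V = {}"
        using snoc.IH snoc.prems(2) by blast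
      then show ?thesis using False v(1)
        by (intro exI[of _ p1] exI[of _ "p2 @ [a]"] exI[of _ w])
          (auto simp: pre_digraph.cas.simps cas_append_ex)
    qed
  qed
  then show thesis using that by blast
qed

text \<open>Following \<open>D\<close> from \<open>d\<close> in both directions until
  \<open>C\<close> is met gives an ear, and its two ends split \<open>C\<close> into the other two
  paths. The common vertices \<open>a\<close> and \<open>b\<close> keep the ends of the ear
  apart.\<close>

lemma (in wf_digraph) theta_in_union:
  assumes C: "C \<in> cycles G" and D: "D \<in> cycles G" and d: "d \<in> D" "d \<notin> C"
    and ab: "a \<noteq> b" "a \<in> ends G C \<inter> ends G D" "b \<in> ends G C \<inter> ends G D"
  shows "\<exists>T\<in>thetas G. T \<subseteq> C \<union> D"
proof -
  let ?B = "bidir G" and ?V = "ends G C"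
  let ?t = "tail (bidir G)" and ?h = "head (bidir G)"
  obtain pc pd where pc: "simple_closed_walk G pc" "C = edges_of pc"
    and pd: "simple_closed_walk G pd" "D = edges_of pd"
    using C D by (auto simp: cycles_def)
  obtain dir where "(d, dir) \<in> set pd" using d(1) pd(2) by (auto simp: edges_of_def)
  then obtain d1 d2 where split: "pd = d1 @ (d, dir) # d2" by (meson split_list)
  define x where "x = (d, dir)"
  define p' where "p' = d2 @ d1"
  have scw: "simple_closed_walk G (x # p')"
    using pd(1) simple_closed_walk_rotate[of d1 "(d, dir) # d2"] split by (simp add: x_def p'_def)
  then have cas: "pre_digraph.cas ?B (?h x) p' (?t x)" and dist: "distinct (map ?t (x # p'))"
    and arcs: "set (x # p') \<subseteq> arcs ?B" and closed: "pre_digraph.cas ?B (?t x) (x # p') (?t x)"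
    unfolding simple_closed_walk_iff by (auto simp: pre_digraph.cas.simps)
  have D_edges: "D = edges_of (x # p')"
    using pd(2) split by (auto simp: x_def p'_def)
  have D_ends: "ends G D = insert (?t x) (?t ` set p')"
    using ends_closed_walk[OF closed] D_edges by simp
  have hit: "\<exists>w\<in>insert (?t x) (?t ` set p'). w \<in> ?V" using ab(2) D_ends by blast
  obtain p1 r v where p1: "p' = p1 @ r" "pre_digraph.cas ?B (?h x) p1 v"
      "pre_digraph.cas ?B v r (?t x)" "v \<in> ?V" "?t ` set p1 \<inter> ?V = {}"
    by (rule cas_first_hit[OF cas hit])
  obtain p2 p3 u where p3: "r = p2 @ p3" "pre_digraph.cas ?B v p2 u"
      "pre_digraph.cas ?B u p3 (?t x)" "u \<in> ?V" "?h ` set p3 \<inter> ?V = {}"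
    by (rule cas_last_hit[OF p1(3,4)])
  have th: "insert (?t x) (?t ` set p3) = insert u (?h ` set p3)"
    using cas_tails_heads[OF p3(3)] .
  have v_p2: "v \<in> ?t ` set p2" if "p2 \<noteq> []"
    using that p3(2) by (cases p2) (auto simp: pre_digraph.cas.simps)
  have dist': "distinct (map ?t (x # p1 @ p2 @ p3))" using dist p1(1) p3(1) by simp
  \<comment> \<open>If the first and the last visit to \<open>C\<close> coincide, the middle piece
    \<open>p2\<close> is empty and \<open>D\<close> meets \<open>C\<close> in that vertex
    alone.\<close>
  have "u \<noteq> v"
  proof
    assume "u = v"
    have "v \<notin> ?t ` set p2"
    proof -
      have "v \<in> insert (?t x) (?t ` set p3)" unfolding th using \<open>u = v\<close> by simp
      moreover have "insert (?t x) (?t ` set p3) \<inter> ?t ` set p2 = {}" using dist' by auto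
      ultimately show ?thesis by blast
    qed
    then have "p2 = []" using v_p2 by blast
    then have "ends G D = ?t ` set p1 \<union> insert u (?h ` set p3)"
      unfolding D_ends p1(1) p3(1) th[symmetric] by auto
    then have "a = u" "b = u" using ab(2,3) p1(5) p3(5) by blast+
    then show False using ab(1) by simp
  qed
  then have "p2 \<noteq> []" using p3(2) by (auto simp: pre_digraph.cas.simps)
  \<comment> \<open>the segment of \<open>D\<close> through \<open>d\<close> between two consecutive visits to \<open>C\<close>\<close>
  define q where "q = p3 @ x # p1"
  have cas_q: "pre_digraph.cas ?B u q v"
    using p1(2) p3(3) by (auto simp: q_def cas_append_ex pre_digraph.cas.simps)
  have "v \<notin> ?t ` set q"
  proof -
    have "?t ` set q \<inter> ?t ` set p2 = {}" using dist' by (auto simp: q_def simp del: bidir_simps)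
    then show ?thesis using v_p2[OF \<open>p2 \<noteq> []\<close>] by blast
  qed
  have set_q: "set q \<subseteq> arcs ?B" using arcs p1(1) p3(1) by (auto simp: q_def)
  have V_verts: "ends G C \<subseteq> verts G"
    using pc by (auto simp: ends_def simple_closed_walk_iff edges_of_def)
  have path_q: "pre_digraph.apath ?B u q v"
    unfolding apath_iff using cas_q \<open>v \<notin> ?t ` set q\<close> set_q V_verts p3(4) dist'
    by (auto simp: q_def)
  have "ends G (edges_of q) = insert v (?t ` set q)"
    using ends_walk[OF cas_q] by (simp add: q_def)
  also have "\<dots> = {v} \<union> insert (?t x) (?t ` set p3) \<union> ?t ` set p1"
    by (auto simp: q_def)
  finally have ends_q: "ends G (edges_of q) \<inter> ?V = {u, v}"
    unfolding th using p1(4,5) p3(4,5) by auto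
  \<comment> \<open>Every edge of the ear other than \<open>d\<close> has an end off
    \<open>C\<close>. The edge \<open>d\<close> itself may be a chord of \<open>C\<close>, so
    \<open>d \<notin> C\<close> has to be used.\<close>
  have q_C: "disjnt (edges_of q) C"
  proof -
    have in_ends: "?t y \<in> ?V" "?h y \<in> ?V" if "fst y \<in> C" for y
      using that by (cases y; auto simp: ends_def)+
    have "fst y \<notin> C" if "y \<in> set p1 \<or> y \<in> set p3" for y
      using that in_ends[of y] p1(5) p3(5) by blast
    then show ?thesis using d(2) by (auto simp: disjnt_def edges_of_def q_def x_def)
  qed
  obtain w where "pre_digraph.cas ?B w pc w" using pc(1) unfolding simple_closed_walk_iff by blast
  then have "u \<in> ?t ` set pc" using p3(4) pc(2) ends_closed_walk by metis
  then obtain y where "y \<in> set pc" "?t y = u" by (metis imageE)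
  then obtain c1 c2 where c: "pc = c1 @ y # c2" by (meson split_list)
  have scw_c: "simple_closed_walk G (y # c2 @ c1)"
    using pc(1) simple_closed_walk_rotate[of c1 "y # c2"] c by simp
  then have cas_c: "pre_digraph.cas ?B u (y # c2 @ c1) u"
    using \<open>?t y = u\<close> unfolding simple_closed_walk_iff by (auto simp: pre_digraph.cas.simps)
  have C_edges: "C = edges_of (y # c2 @ c1)" using pc(2) c by auto
  have "?V = ?t ` set (y # c2 @ c1)" using ends_closed_walk[OF cas_c] C_edges by simp
  then have hit_v: "\<exists>w\<in>insert u (?t ` set (y # c2 @ c1)). w \<in> {v}" using p1(4) by blast
  obtain p r' where pr: "y # c2 @ c1 = p @ r'" "pre_digraph.cas ?B u p v"
      "pre_digraph.cas ?B v r' u" "v \<notin> ?t ` set p"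
    by (rule cas_first_hit[OF cas_c hit_v]) auto
  have ne: "p \<noteq> []" "r' \<noteq> []" using pr(2,3) \<open>u \<noteq> v\<close> by (auto simp: pre_digraph.cas.simps)
  have dist_pr: "distinct (map fst (p @ r'))" "distinct (map ?t (p @ r'))" "set (p @ r') \<subseteq> arcs ?B"
    using scw_c unfolding pr(1) simple_closed_walk_iff by auto
  have u_p: "u \<in> ?t ` set p" using ne(1) pr(2) by (cases p) (auto simp: pre_digraph.cas.simps)
  have v_r: "v \<in> ?t ` set r'" using ne(2) pr(3) by (cases r') (auto simp: pre_digraph.cas.simps)
  have uv: "u \<in> verts ?B" "v \<in> verts ?B" using V_verts p1(4) p3(4) by auto
  have path_p: "pre_digraph.apath ?B u p v"
    unfolding apath_iff using pr(2,4) dist_pr uv by simp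
  have tp_tr: "?t ` set p \<inter> ?t ` set r' = {}" using dist_pr(2) by (auto simp del: bidir_simps)
  have "u \<notin> ?t ` set r'" using u_p tp_tr by blast
  then have "pre_digraph.apath ?B v r' u"
    unfolding apath_iff using pr(3) dist_pr uv by simp
  \<comment> \<open>\<open>thetas\<close> wants all three paths directed from \<open>u\<close> to
    \<open>v\<close>, while continuing around \<open>C\<close> leads from \<open>v\<close> back to
    \<open>u\<close>.\<close>
  then have path_r: "pre_digraph.apath ?B u (rev_walk r') v" by (rule apath_rev_walk)
  have ends_pr: "ends G (edges_of p) = insert v (?t ` set p)" "ends G (edges_of r') = insert u (?t ` set r')"
    using ends_walk[OF pr(2) ne(1)] ends_walk[OF pr(3) ne(2)] .
  have ends_p_r: "ends G (edges_of p) \<inter> ends G (edges_of r') = {u, v}"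
    unfolding ends_pr using u_p v_r pr(4) \<open>u \<notin> ?t ` set r'\<close> tp_tr by blast
  have C_eq: "C = edges_of p \<union> edges_of r'" using C_edges pr(1) by (metis edges_of_simps(3))
  then have "?V = ends G (edges_of p) \<union> ends G (edges_of r')" by (auto simp: ends_def)
  then have ends_q': "ends G (edges_of p) \<inter> ends G (edges_of q) = {u, v}"
      "ends G (edges_of q) \<inter> ends G (edges_of r') = {u, v}"
    using ends_q ends_p_r by blast+
  have disj: "disjnt (edges_of p) (edges_of q)" "disjnt (edges_of q) (edges_of r')"
    "disjnt (edges_of p) (edges_of r')"
    using q_C C_eq dist_pr(1) by (auto simp: disjnt_def edges_of_def)
  have "edges_of p \<union> edges_of q \<union> edges_of (rev_walk r') \<in> thetas G"
    unfolding thetas_def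
    using \<open>u \<noteq> v\<close> path_p path_q path_r ends_q' ends_p_r disj
    by (intro CollectI exI[of _ u] exI[of _ v] exI[of _ p] exI[of _ q] exI[of _ "rev_walk r'"]) simp
  moreover have "edges_of q \<subseteq> D" using D_edges p1(1) p3(1) by (auto simp: q_def)
  ultimately show ?thesis using C_eq
    by (intro bexI[of _ "edges_of p \<union> edges_of q \<union> edges_of (rev_walk r')"]) auto
qed

section \<open>Recognising the lift extension\<close>

lemma LG_graph_simps [simp]:
  "verts (LG_graph k \<Gamma>) = {..<k}"
  "arcs (LG_graph k \<Gamma>) = {(i, j, g). i < j \<and> j < k \<and> g \<in> carrier \<Gamma>}"
  "tail (LG_graph k \<Gamma>) (i, j, g) = i"
  "head (LG_graph k \<Gamma>) (i, j, g) = j"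
  by (simp_all add: LG_graph_def)

lemma wf_LG_graph: "wf_digraph (LG_graph k \<Gamma>)"
  by unfold_locales auto

text \<open>\<open>forest\<close> describes the contraction of \<open>e0\<close>,
  \<open>pair_indep\<close> makes digons span \<open>e0\<close>, and \<open>triangle\<close> ties
  dependence to the group. Triangles are required for increasing vertices only;
  \<open>ed_triangle\<close> supplies all other directions.\<close>

locale lift_labelling = matroid M + group \<Gamma>
  for M :: "(nat \<times> nat \<times> 'g) indep_structure" and \<Gamma> :: "('g, 'm) monoid_scheme" (structure) +
  fixes k :: nat and e0 :: "nat \<times> nat \<times> 'g"
  assumes e0_new: "e0 \<notin> arcs (LG_graph k \<Gamma>)"
    and ground_eq: "ground M = insert e0 (arcs (LG_graph k \<Gamma>))"
    and forest: "Y \<subseteq> arcs (LG_graph k \<Gamma>) \<Longrightarrow>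
      insert e0 Y \<in> indeps M \<longleftrightarrow> \<not> (\<exists>C\<in>cycles (LG_graph k \<Gamma>). C \<subseteq> Y)"
    and pair_indep: "i < j \<Longrightarrow> j < k \<Longrightarrow> g \<in> carrier \<Gamma> \<Longrightarrow> h \<in> carrier \<Gamma> \<Longrightarrow>
      {(i, j, g), (i, j, h)} \<in> indeps M"
    and triangle: "i < j \<Longrightarrow> j < l \<Longrightarrow> l < k \<Longrightarrow> g \<in> carrier \<Gamma> \<Longrightarrow> h \<in> carrier \<Gamma> \<Longrightarrow>
      {(i, j, g), (j, l, h), (i, l, g \<otimes> h)} \<notin> indeps M"
begin

abbreviation G :: "(nat, nat \<times> nat \<times> 'g) pre_digraph" where
  "G \<equiv> LG_graph k \<Gamma>"

text \<open>The edge between \<open>u\<close> and \<open>v\<close> that contributes \<open>g\<close> when traversed from \<open>u\<close> to \<open>v\<close>.\<close>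

definition ed :: "nat \<Rightarrow> nat \<Rightarrow> 'g \<Rightarrow> nat \<times> nat \<times> 'g" where
  "ed u v g = (if u < v then (u, v, g) else (v, u, inv g))"

sublocale wf_digraph G
  by (rule wf_LG_graph)

lemma ed_arc: "u \<noteq> v \<Longrightarrow> u < k \<Longrightarrow> v < k \<Longrightarrow> g \<in> carrier \<Gamma> \<Longrightarrow> ed u v g \<in> arcs G"
  by (auto simp: ed_def)

lemma ed_swap: "u \<noteq> v \<Longrightarrow> g \<in> carrier \<Gamma> \<Longrightarrow> ed v u (inv g) = ed u v g"
  by (auto simp: ed_def)

lemma ed_inj: "u \<noteq> v \<Longrightarrow> g \<in> carrier \<Gamma> \<Longrightarrow> h \<in> carrier \<Gamma> \<Longrightarrow> ed u v g = ed u v h \<Longrightarrow> g = h"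
  by (auto simp: ed_def split: if_splits dest: inv_inj[THEN inj_onD])

lemma loopless: "e \<in> arcs G \<Longrightarrow> tail G e \<noteq> head G e"
  by auto

lemma arcs_ground: "Y \<subseteq> arcs G \<Longrightarrow> insert e0 Y \<subseteq> ground M"
  using ground_eq by auto

lemma adjacent_indep:
  assumes "a \<in> arcs G" "b \<in> arcs G" "u \<in> {tail G a, head G a}" "u \<in> {tail G b, head G b}"
    "{tail G a, head G a} \<noteq> {tail G b, head G b}"
  shows "{e0, a, b} \<in> indeps M"
proof -
  have sub: "{a, b} \<subseteq> arcs G" using assms by blast
  have "\<not> (\<exists>C\<in>cycles G. C \<subseteq> {a, b})"
  proof (rule star_acyclic[OF sub])
    show "tail G e \<noteq> head G e" if "e \<in> {a, b}" for e
      using that sub loopless by blast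
    show "u \<in> {tail G e, head G e}" if "e \<in> {a, b}" for e
      using that assms(3,4) by blast
    show "e = f" if "e \<in> {a, b}" "f \<in> {a, b}" "{tail G e, head G e} = {tail G f, head G f}" for e f
      using that assms(5) by blast
  qed
  then show ?thesis using forest[OF sub] by blast
qed

lemma single_indep: "a \<in> arcs G \<Longrightarrow> {e0, a} \<in> indeps M"
  using forest[of "{a}"] star_acyclic[of "{a}" "tail G a"] loopless by auto

lemma triangle_cl:
  assumes "i < j" "j < l" "l < k" "g \<in> carrier \<Gamma>" "h \<in> carrier \<Gamma>" "m = g \<otimes> h"
  shows "(i, j, g) \<in> cl {(j, l, h), (i, l, m)}" "(j, l, h) \<in> cl {(i, j, g), (i, l, m)}"
    "(i, l, m) \<in> cl {(i, j, g), (j, l, h)}"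
proof -
  let ?a = "(i, j, g)" and ?b = "(j, l, h)" and ?c = "(i, l, m)"
  have arcs: "?a \<in> arcs G" "?b \<in> arcs G" "?c \<in> arcs G" using assms by auto
  have "{e0, ?b, ?c} \<in> indeps M" "{e0, ?a, ?c} \<in> indeps M" "{e0, ?a, ?b} \<in> indeps M"
    using adjacent_indep[OF arcs(2,3), of l] adjacent_indep[OF arcs(1,3), of i]
      adjacent_indep[OF arcs(1,2), of j] assms(1,2) by (auto simp: doubleton_eq_iff)
  then have indep: "{?b, ?c} \<in> indeps M" "{?a, ?c} \<in> indeps M" "{?a, ?b} \<in> indeps M"
    using indeps_down by blast+
  have dep: "{?a, ?b, ?c} \<notin> indeps M" "{?b, ?a, ?c} \<notin> indeps M" "{?c, ?a, ?b} \<notin> indeps M"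
    using triangle[OF assms(1-5)] assms(6) by (simp_all add: insert_commute)
  have "?a \<in> ground M" "?b \<in> ground M" "?c \<in> ground M" using arcs ground_eq by auto
  then show "?a \<in> cl {?b, ?c}" "?b \<in> cl {?a, ?c}" "?c \<in> cl {?a, ?b}"
    using clI[OF indep(1) order_refl _ dep(1)] clI[OF indep(2) order_refl _ dep(2)]
      clI[OF indep(3) order_refl _ dep(3)] by blast+
qed

text \<open>In each of the six orders of the vertices, solving the product for the label of the
  longest edge turns the claim into one of the three closures of an increasing triangle.\<close>

lemma ed_triangle:
  assumes "u \<noteq> v" "v \<noteq> w" "u \<noteq> w" "u < k" "v < k" "w < k" "g \<in> carrier \<Gamma>" "h \<in> carrier \<Gamma>"
  shows "ed u w (g \<otimes> h) \<in> cl {ed u v g, ed v w h}"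
proof -
  note mems = assms(7,8) m_closed[OF assms(7,8)] inv_closed[OF assms(7)] inv_closed[OF assms(8)]
    inv_closed[OF m_closed[OF assms(7,8)]]
  have eqs: "g = (g \<otimes> h) \<otimes> inv h" "h = inv g \<otimes> (g \<otimes> h)" "inv g = h \<otimes> inv (g \<otimes> h)"
    "inv h = inv (g \<otimes> h) \<otimes> g" "inv (g \<otimes> h) = inv h \<otimes> inv g"
    using assms(7,8) by (simp_all add: m_assoc inv_mult_group m_assoc[symmetric])
  consider "u < v" "v < w" | "u < w" "w < v" | "v < u" "u < w" | "v < w" "w < u" |
    "w < u" "u < v" | "w < v" "v < u"
    using assms(1-3) by linarith
  then show ?thesis
  proof cases
    case 1
    then show ?thesis
      using triangle_cl(3)[of u v w g h "g \<otimes> h"] mems assms by (simp add: ed_def)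
  next
    case 2
    then show ?thesis
      using triangle_cl(1)[of u w v "g \<otimes> h" "inv h" g] mems assms eqs(1)
      by (simp add: ed_def insert_commute)
  next
    case 3
    then show ?thesis
      using triangle_cl(2)[of v u w "inv g" "g \<otimes> h" h] mems assms eqs(2)
      by (simp add: ed_def insert_commute)
  next
    case 4
    then show ?thesis
      using triangle_cl(2)[of v w u h "inv (g \<otimes> h)" "inv g"] mems assms eqs(3)
      by (simp add: ed_def insert_commute)
  next
    case 5
    then show ?thesis
      using triangle_cl(1)[of w u v "inv (g \<otimes> h)" g "inv h"] mems assms eqs(4)
      by (simp add: ed_def insert_commute)
  next
    case 6
    then show ?thesis
      using triangle_cl(3)[of w v u "inv h" "inv g" "inv (g \<otimes> h)"] mems assms eqs(5)
      by (simp add: ed_def insert_commute)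
  qed
qed

lemma ed_parallel_dep:
  assumes "u \<noteq> v" "u < k" "v < k" "g \<in> carrier \<Gamma>" "h \<in> carrier \<Gamma>" "g \<noteq> h"
  shows "{e0, ed u v g, ed u v h} \<notin> indeps M"
proof -
  let ?a = "ed u v g" and ?b = "ed u v h"
  have ne: "?a \<noteq> ?b" using ed_inj assms by blast
  have "joined G ({?a, ?b} - {?a}) (tail G ?a) (head G ?a)"
    using joined_edge[of ?b "{?a, ?b} - {?a}" G] ne by (auto simp: ed_def)
  then have "\<exists>C\<in>cycles G. C \<subseteq> {?a, ?b}"
    using has_cycle_iff[of "{?a, ?b}"] ed_arc assms by blast
  then show ?thesis using forest[of "{?a, ?b}"] ed_arc assms by auto
qed

lemma ed_parallel_cl:
  assumes "u \<noteq> v" "u < k" "v < k" "g \<in> carrier \<Gamma>" "h \<in> carrier \<Gamma>"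
  shows "ed u v g \<in> cl {e0, ed u v h}"
proof (cases "g = h")
  case True
  then show ?thesis using subset_cl[of "{e0, ed u v h}"] ed_arc assms ground_eq by auto
next
  case False
  show ?thesis
  proof (rule clI[OF single_indep order_refl])
    show "ed u v h \<in> arcs G" "ed u v g \<in> ground M" using ed_arc assms ground_eq by auto
    show "insert (ed u v g) {e0, ed u v h} \<notin> indeps M"
      using ed_parallel_dep[of u v g h] assms False by (simp add: insert_commute)
  qed
qed

lemma e0_cl_parallel:
  assumes "u \<noteq> v" "u < k" "v < k" "g \<in> carrier \<Gamma>" "h \<in> carrier \<Gamma>" "g \<noteq> h"
  shows "e0 \<in> cl {ed u v g, ed u v h}"
proof (rule clI[OF _ order_refl])
  show "{ed u v g, ed u v h} \<in> indeps M"
    using pair_indep assms by (auto simp: ed_def)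
  show "e0 \<in> ground M" using ground_eq by simp
  show "insert e0 {ed u v g, ed u v h} \<notin> indeps M" using ed_parallel_dep assms by simp
qed

lemma edge_as_ed:
  assumes "e \<in> arcs G"
  obtains g where "g \<in> carrier \<Gamma>" "e = ed (tail G e) (head G e) g" "e = ed (head G e) (tail G e) (inv g)"
  using assms by (auto simp: ed_def)

text \<open>With \<open>e0\<close> in the span, labels cease to matter. The induction needs all
  labels at once: to arrive with label \<open>h\<close> over a last edge labelled \<open>g\<close>,
  the previous vertex must be reached with label \<open>h \<otimes> inv g\<close>.\<close>

lemma joined_cl:
  assumes "Y \<subseteq> arcs G" "u < k" "joined G Y u v"
  shows "v < k \<and> (u \<noteq> v \<longrightarrow> (\<forall>g\<in>carrier \<Gamma>. ed u v g \<in> cl (insert e0 Y)))"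
  using assms(3) unfolding joined_def
proof (induction rule: rtrancl_induct)
  case base
  then show ?case using assms(2) by simp
next
  case (step y z)
  have sub: "insert e0 Y \<subseteq> ground M" by (rule arcs_ground[OF assms(1)])
  note sc = subset_cl[OF sub]
  obtain e where e: "e \<in> Y" "(y = tail G e \<and> z = head G e) \<or> (y = head G e \<and> z = tail G e)"
    using step(2) by (auto simp: adj_rel_def)
  then have "e \<in> arcs G" using assms(1) by blast
  then obtain g where g: "g \<in> carrier \<Gamma>" "e = ed y z g"
    using e(2) by (metis edge_as_ed inv_closed)
  have yz: "y \<noteq> z" "y < k" "z < k"
    using e(2) \<open>e \<in> arcs G\<close> loopless[OF \<open>e \<in> arcs G\<close>] by auto
  have "e \<in> cl (insert e0 Y)" "e0 \<in> cl (insert e0 Y)" using sc e(1) by auto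
  have "ed u z h \<in> cl (insert e0 Y)" if h: "h \<in> carrier \<Gamma>" and "u \<noteq> z" for h
  proof (cases "u = y")
    case True
    then show ?thesis
      using in_cl_trans[OF ed_parallel_cl[OF yz h g(1)] _ sub] g(2) \<open>e \<in> cl _\<close> \<open>e0 \<in> cl _\<close>
      by simp
  next
    case False
    have "h \<otimes> inv g \<in> carrier \<Gamma>" "(h \<otimes> inv g) \<otimes> g = h" using h g(1) by (simp_all add: m_assoc)
    then have "ed u z h \<in> cl {ed u y (h \<otimes> inv g), ed y z g}"
      using ed_triangle[of u y z "h \<otimes> inv g" g] False yz assms(2) \<open>u \<noteq> z\<close> g(1) by simp
    moreover have "ed u y (h \<otimes> inv g) \<in> cl (insert e0 Y)"
      using step.IH False \<open>h \<otimes> inv g \<in> carrier \<Gamma>\<close> by blast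
    ultimately show ?thesis using in_cl_trans[OF _ _ sub] g(2) \<open>e \<in> cl _\<close> by simp
  qed
  then show ?case using yz(3) by blast
qed

lemma joined_edge_cl:
  assumes "Y \<subseteq> arcs G" "e \<in> arcs G" "joined G Y (tail G e) (head G e)"
  shows "e \<in> cl (insert e0 Y)"
  using joined_cl[OF assms(1) _ assms(3)] edge_as_ed[OF assms(2)] assms(2) loopless
  by (metis lessThan_iff tail_in_verts LG_graph_simps(1))

section \<open>Walk labels and the closure of paths and cycles\<close>

abbreviation arc_label :: "(nat \<times> nat \<times> 'g) \<times> bool \<Rightarrow> 'g" where
  "arc_label a \<equiv> (if snd a then LG_label (fst a) else inv (LG_label (fst a)))"

lemma walk_label_Nil: "walk_label \<Gamma> LG_label [] = \<one>"
  by (simp add: walk_label_def)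

lemma walk_label_Cons: "walk_label \<Gamma> LG_label (a # p) = arc_label a \<otimes> walk_label \<Gamma> LG_label p"
  by (cases a) (simp add: walk_label_def)

lemma arc_as_ed:
  assumes "a \<in> arcs (bidir G)"
  shows "arc_label a \<in> carrier \<Gamma>" "fst a = ed (tail (bidir G) a) (head (bidir G) a) (arc_label a)"
    "tail (bidir G) a \<noteq> head (bidir G) a" "tail (bidir G) a < k" "head (bidir G) a < k"
proof -
  obtain i j g d where a: "a = ((i, j, g), d)" by (metis surj_pair)
  have "i < j" "j < k" "g \<in> carrier \<Gamma>" using assms a by auto
  then show "arc_label a \<in> carrier \<Gamma>" "fst a = ed (tail (bidir G) a) (head (bidir G) a) (arc_label a)"
    "tail (bidir G) a \<noteq> head (bidir G) a" "tail (bidir G) a < k" "head (bidir G) a < k"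
    by (cases d; simp add: a ed_def LG_label_def)+
qed

text \<open>Triangles shorten the path: its first edge and the single edge standing for the rest
  span the edge with the product label. Distinct vertices make this a genuine triangle at every
  step.\<close>

lemma path_cl:
  assumes "pre_digraph.apath (bidir G) u p v" "p \<noteq> []"
  shows "walk_label \<Gamma> LG_label p \<in> carrier \<Gamma> \<and> ed u v (walk_label \<Gamma> LG_label p) \<in> cl (edges_of p)"
  using assms
proof (induction p arbitrary: u)
  case Nil
  then show ?case by simp
next
  case (Cons a p)
  let ?B = "bidir G"
  interpret B: wf_digraph ?B by (rule wf_bidir)
  let ?y = "head ?B a" and ?l = "walk_label \<Gamma> LG_label"
  have a: "a \<in> arcs ?B" "tail ?B a = u" and p: "B.apath ?y p v"
    and new: "u \<notin> set (B.awalk_verts ?y p)"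
    using Cons.prems(1) by (auto simp: B.apath_Cons_iff)
  note a' = arc_as_ed[OF a(1), unfolded a(2)]
  have arcs: "edges_of (a # p) \<subseteq> arcs G"
    using Cons.prems(1) by (auto simp: apath_iff edges_of_def)
  then have sub: "edges_of (a # p) \<subseteq> ground M" using arcs_ground by blast
  note sc = subset_cl[OF sub]
  show ?case
  proof (cases "p = []")
    case True
    have "?l [a] = arc_label a" using a'(1) by (simp add: walk_label_Cons walk_label_Nil del: if_split)
    moreover have "v = ?y" using p True by (auto simp: B.apath_Nil_iff)
    ultimately show ?thesis using a'(1,2) sc True by auto
  next
    case False
    have IH: "?l p \<in> carrier \<Gamma>" "ed ?y v (?l p) \<in> cl (edges_of p)"
      using Cons.IH[OF p False] by auto
    have "?y \<noteq> v" using B.apath_nonempty_ends[OF p False] .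
    have "v \<in> set (B.awalk_verts ?y p)"
      using p cas_verts[of ?B ?y p v] by (simp add: B.apath_def B.awalk_def)
    then have "u \<noteq> v" using new by blast
    have "v < k" using B.awalk_last_in_verts[OF B.awalkI_apath[OF p]] by simp
    have "ed u v (?l (a # p)) \<in> cl {ed u ?y (arc_label a), ed ?y v (?l p)}"
      unfolding walk_label_Cons
      using ed_triangle[OF a'(3) \<open>?y \<noteq> v\<close> \<open>u \<noteq> v\<close> a'(4,5) \<open>v < k\<close> a'(1) IH(1)] .
    moreover have "{ed u ?y (arc_label a), ed ?y v (?l p)} \<subseteq> cl (edges_of (a # p))"
      using sc a'(2) IH(2) cl_mono[of "edges_of p" "edges_of (a # p)"] by auto
    ultimately have "ed u v (?l (a # p)) \<in> cl (edges_of (a # p))" by (rule in_cl_trans[OF _ _ sub])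
    then show ?thesis using a'(1) IH(1) unfolding walk_label_Cons by simp
  qed
qed

text \<open>Without its first edge the cycle is a path, whose closure contains an edge with the same
  ends as the removed one. If the label is trivial the two edges coincide and the cycle is
  dependent; otherwise they form a digon, which spans \<open>e0\<close>.\<close>

lemma cycle_cl:
  assumes "simple_closed_walk G p"
  shows "walk_label \<Gamma> LG_label p = \<one> \<Longrightarrow> edges_of p \<notin> indeps M"
    "walk_label \<Gamma> LG_label p \<noteq> \<one> \<Longrightarrow> e0 \<in> cl (edges_of p)"
proof -
  let ?B = "bidir G"
  interpret B: wf_digraph ?B by (rule wf_bidir)
  obtain a p' where p: "p = a # p'"
    using assms by (cases p) (auto simp: simple_closed_walk_iff)
  let ?u = "tail ?B a" and ?y = "head ?B a" and ?l = "walk_label \<Gamma> LG_label"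
  have *: "a \<in> arcs ?B" "B.cas ?y p' ?u" "set p' \<subseteq> arcs ?B" "distinct (map fst p)"
    "distinct (map (tail ?B) p')" "?u \<notin> tail ?B ` set p'"
    using assms p by (auto simp: simple_closed_walk_iff B.cas.simps)
  note a = arc_as_ed[OF *(1)]
  have "p' \<noteq> []" using *(2) a(3) by (auto simp: B.cas.simps)
  have "B.apath ?y p' ?u" unfolding apath_iff using * a(5) by simp
  note p' = path_cl[OF this \<open>p' \<noteq> []\<close>]
  define g l where "g = arc_label a" and "l = ?l p'"
  have g: "g \<in> carrier \<Gamma>" and l: "l \<in> carrier \<Gamma>" and l_cl: "ed ?y ?u l \<in> cl (edges_of p')"
    and lp: "?l p = g \<otimes> l" using a(1) p' p by (simp_all only: g_def l_def walk_label_Cons)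
  have e: "fst a = ed ?y ?u (inv g)"
    unfolding g_def ed_swap[OF a(3,1)] by (rule a(2))
  have sub: "edges_of p \<subseteq> ground M"
    using *(1,3) p ground_eq by (auto simp: edges_of_def)
  have new: "fst a \<notin> edges_of p'" using *(4) p by (auto simp: edges_of_def)
  have label: "?l p = \<one> \<longleftrightarrow> l = inv g"
  proof
    assume "?l p = \<one>"
    then have "inv l = g" unfolding lp by (rule inv_equality) (rule l g)+
    then show "l = inv g" using inv_inv[OF l] by simp
  qed (use g lp in simp)
  show "edges_of p \<notin> indeps M" if "?l p = \<one>"
  proof -
    have "fst a \<in> cl (edges_of p')" using l_cl that label e by simp
    moreover have "edges_of p - {fst a} = edges_of p'" using new p by auto
    ultimately show ?thesis
      using dependent_if_in_cl[of "fst a" "edges_of p"] p by simp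
  qed
  show "e0 \<in> cl (edges_of p)" if "?l p \<noteq> \<one>"
  proof -
    have "e0 \<in> cl {ed ?y ?u l, fst a}"
      unfolding e using e0_cl_parallel[OF a(3)[symmetric] a(5,4) l inv_closed[OF g]] that label by simp
    moreover have "{ed ?y ?u l, fst a} \<subseteq> cl (edges_of p)"
      using subset_cl[OF sub] cl_mono[of "edges_of p'" "edges_of p"] p l_cl by auto
    ultimately show ?thesis by (rule in_cl_trans[OF _ _ sub])
  qed
qed

section \<open>Dependent sets and lift circuits\<close>

lemma balanced_cycle_dependent: "C \<in> balanced_cycles \<Gamma> LG_label G \<Longrightarrow> C \<notin> indeps M"
  using cycle_cl(1) by (auto simp: balanced_cycles_def)

lemma unbalanced_cycle_cl: "C \<in> unbalanced_cycles \<Gamma> LG_label G \<Longrightarrow> e0 \<in> cl C"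
  using cycle_cl(2) by (auto simp: unbalanced_cycles_def balanced_cycles_def cycles_def)

text \<open>Restoring \<open>e\<close> and then \<open>f\<close> closes a cycle each time. Trading
  both for \<open>e0\<close> therefore keeps \<open>X\<close> in the closure of a set with one
  element fewer.\<close>

lemma nullity_two_dependent:
  assumes "X \<subseteq> arcs G" "e \<in> X" "f \<in> X" "e \<noteq> f"
    and "joined G (X - {e, f}) (tail G e) (head G e)" "joined G (X - {f}) (tail G f) (head G f)"
  shows "X \<notin> indeps M"
proof (rule dependent_in_cl)
  let ?Z = "insert e0 (X - {e, f})"
  have sub: "X - {e, f} \<subseteq> arcs G" "X - {f} \<subseteq> arcs G" using assms(1) by auto
  show Z: "?Z \<subseteq> ground M" by (rule arcs_ground[OF sub(1)])
  have e: "e \<in> cl ?Z" using joined_edge_cl[OF sub(1) _ assms(5)] assms(1,2) by blast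
  have "f \<in> cl (insert e0 (X - {f}))" using joined_edge_cl[OF sub(2) _ assms(6)] assms(1,3) by blast
  moreover have "insert e0 (X - {f}) = insert e ?Z" using assms(2,4) by auto
  ultimately have "f \<in> cl ?Z" using cl_trans[OF _ e Z] by simp
  then show "X \<subseteq> cl ?Z" using e subset_cl[OF Z] by auto
  have "finite X" using arcs_ground[OF assms(1)] finite_ground by (meson finite_insert finite_subset)
  moreover have "X = insert e (insert f (X - {e, f}))" using assms(2,3) by blast
  ultimately have "card X = Suc (Suc (card (X - {e, f})))"
    using assms(4) by (metis (no_types, lifting) DiffD2 card_insert_disjoint finite_Diff finite_insert insertCI insertE)
  then show "card ?Z < card X"
    using \<open>finite X\<close> by (simp add: card_insert_if)
qed

text \<open>Without loops, sharing at most one vertex forces the cycles to be edge-disjoint, so an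
  edge can be removed from each without disturbing the other.\<close>

lemma two_cycles_dependent:
  assumes "C \<in> cycles G" "D \<in> cycles G" "ends G C \<inter> ends G D \<subseteq> {v}"
  shows "C \<union> D \<notin> indeps M"
proof -
  obtain e f where ef: "e \<in> C" "f \<in> D"
    using cycles_nonempty[OF assms(1)] cycles_nonempty[OF assms(2)] by blast
  have arcs: "C \<subseteq> arcs G" "D \<subseteq> arcs G"
    using cycle_joined(1)[OF assms(1) ef(1)] cycle_joined(1)[OF assms(2) ef(2)] .
  have disj: "C \<inter> D = {}"
  proof (rule ccontr)
    assume "C \<inter> D \<noteq> {}"
    then obtain g where "g \<in> C" "g \<in> D" by blast
    then have "tail G g = v" "head G g = v" using assms(3) unfolding ends_def by blast+
    then show False using loopless[of g] \<open>g \<in> C\<close> arcs(1) by fastforce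
  qed
  show ?thesis
  proof (rule nullity_two_dependent)
    show "joined G (C \<union> D - {e, f}) (tail G e) (head G e)"
      by (rule joined_mono[OF cycle_joined(2)[OF assms(1) ef(1)]]) (use disj ef in auto)
    show "joined G (C \<union> D - {f}) (tail G f) (head G f)"
      by (rule joined_mono[OF cycle_joined(2)[OF assms(2) ef(2)]]) auto
  qed (use ef arcs disj in auto)
qed

text \<open>The first edges of \<open>q\<close> and \<open>r\<close> serve as the two removable
  edges: the ends of each stay joined by running along \<open>p\<close> and back over the rest of
  its own path.\<close>

lemma theta_dependent:
  assumes "X \<in> thetas G"
  shows "X \<notin> indeps M"
proof -
  let ?B = "bidir G"
  interpret B: wf_digraph ?B by (rule wf_bidir)
  obtain u v p q r where X: "X = edges_of p \<union> edges_of q \<union> edges_of r" "u \<noteq> v"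
    and path: "B.apath u p v" "B.apath u q v" "B.apath u r v"
    and disj: "disjnt (edges_of p) (edges_of q)" "disjnt (edges_of p) (edges_of r)"
      "disjnt (edges_of q) (edges_of r)"
    using assms unfolding thetas_def by auto
  have "s \<noteq> []" if "B.apath u s v" for s using that X(2) by (auto simp: B.apath_Nil_iff)
  then obtain a q' b r' where q: "q = a # q'" and r: "r = b # r'"
    using path by (metis neq_Nil_conv)
  have joined: "joined G (Y - {fst a}) (tail G (fst a)) (head G (fst a))"
    if ap: "B.apath u (a # q') v" and "edges_of p \<union> edges_of q' \<subseteq> Y" "fst a \<notin> edges_of p" for a q' Y
  proof -
    have "distinct (map fst (a # q'))" by (rule apath_distinct_edges[OF ap])
    then have "fst a \<notin> edges_of q'" by (simp add: edges_of_def)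
    then have *: "edges_of p \<union> edges_of q' \<subseteq> Y - {fst a}" using that(2,3) by blast
    have "B.cas u p v" "B.cas (head ?B a) q' v" "tail ?B a = u"
      using path(1) ap by (auto simp: apath_iff B.cas.simps)
    then have "joined G (edges_of p) u v" "joined G (edges_of q') (head ?B a) v"
      using walk_joined by blast+
    then have "joined G (Y - {fst a}) u v" "joined G (Y - {fst a}) v (head ?B a)"
      using * joined_mono[of G "edges_of p" u v] joined_sym[OF joined_mono[of G "edges_of q'" "head ?B a" v]]
      by simp_all
    then have "joined G (Y - {fst a}) (tail ?B a) (head ?B a)"
      unfolding \<open>tail ?B a = u\<close> by (rule joined_trans)
    from this joined_sym[OF this] show ?thesis by (cases a; cases "snd a") simp_all
  qed
  have arcs: "X \<subseteq> arcs G" using path X(1) by (auto simp: apath_iff edges_of_def)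
  have ab: "fst a \<notin> edges_of p" "fst b \<notin> edges_of p" "fst a \<noteq> fst b" "fst b \<notin> edges_of q'"
    using disj unfolding q r by (auto simp: disjnt_def)
  show ?thesis
  proof (rule nullity_two_dependent[OF arcs])
    show "fst a \<in> X" "fst b \<in> X" "fst a \<noteq> fst b" using X(1) q r ab(3) by auto
    show "joined G (X - {fst b}) (tail G (fst b)) (head G (fst b))"
      using joined[of b r' X] path(3) X(1) r ab(2) by auto
    have "joined G ((X - {fst b}) - {fst a}) (tail G (fst a)) (head G (fst a))"
    proof (rule joined)
      show "B.apath u (a # q') v" using path(2) q by simp
      show "edges_of p \<union> edges_of q' \<subseteq> X - {fst b}" using X(1) q ab by auto
    qed (rule ab(1))
    moreover have "X - {fst b} - {fst a} = X - {fst a, fst b}" by blast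
    ultimately show "joined G (X - {fst a, fst b}) (tail G (fst a)) (head G (fst a))"
      by (simp only:)
  qed
qed

lemma lift_circuit_dependent:
  assumes "X \<in> lift_circuits \<Gamma> LG_label G"
  shows "X \<notin> indeps M"
  using assms unfolding lift_circuits_def
proof (elim UnE)
  assume "X \<in> balanced_cycles \<Gamma> LG_label G"
  then show ?thesis by (rule balanced_cycle_dependent)
next
  assume "X \<in> {C \<union> D | C D. C \<in> unbalanced_cycles \<Gamma> LG_label G \<and> D \<in> unbalanced_cycles \<Gamma> LG_label G \<and>
          ends G C \<inter> ends G D = {}}"
  then obtain C D where "X = C \<union> D" "C \<in> cycles G" "D \<in> cycles G" "ends G C \<inter> ends G D = {}"
    by (auto simp: unbalanced_cycles_def)
  \<comment> \<open>Any vertex bounds an empty intersection.\<close>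
  then show ?thesis using two_cycles_dependent[of C D undefined] by simp
next
  assume "X \<in> {C \<union> D | C D. C \<in> unbalanced_cycles \<Gamma> LG_label G \<and> D \<in> unbalanced_cycles \<Gamma> LG_label G \<and>
          (\<exists>v. ends G C \<inter> ends G D = {v})}"
  then obtain C D v where "X = C \<union> D" "C \<in> cycles G" "D \<in> cycles G" "ends G C \<inter> ends G D = {v}"
    by (auto simp: unbalanced_cycles_def)
  then show ?thesis using two_cycles_dependent[of C D v] by simp
next
  assume "X \<in> {X \<in> thetas G. \<forall>C\<in>cycles G. C \<subseteq> X \<longrightarrow> C \<in> unbalanced_cycles \<Gamma> LG_label G}"
  then show ?thesis using theta_dependent by simp
qed

lemma dependent_contains_lift_circuit:
  assumes "X \<subseteq> arcs G" "X \<notin> indeps M"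
  shows "\<exists>C\<in>lift_circuits \<Gamma> LG_label G. C \<subseteq> X"
proof (rule ccontr)
  assume no: "\<not> ?thesis"
  have "insert e0 X \<notin> indeps M" using assms(2) indeps_down by blast
  then obtain C where C: "C \<in> cycles G" "C \<subseteq> X" using forest[OF assms(1)] by blast
  then obtain c where c: "c \<in> C" using cycles_nonempty by blast
  \<comment> \<open>A balanced cycle inside \<open>X\<close> would itself be a lift circuit.\<close>
  have bal: "D \<in> unbalanced_cycles \<Gamma> LG_label G" if "D \<in> cycles G" "D \<subseteq> X" for D
    using that no unfolding unbalanced_cycles_def lift_circuits_def by blast
  have sub: "X - {c} \<subseteq> arcs G" using assms(1) by blast
  \<comment> \<open>In the first case \<open>e0\<close> would be outside the closure of \<open>X\<close>, so the cycle \<open>C\<close> would be balanced;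
    otherwise \<open>X\<close> contains a second cycle.\<close>
  show False
  proof (cases "insert e0 (X - {c}) \<in> indeps M")
    case True
    have e0: "e0 \<in> cl X" using unbalanced_cycle_cl[OF bal[OF C]] cl_mono[OF C(2)] by blast
    have indep: "X - {c} \<in> indeps M" using True indeps_down by blast
    have "c \<in> ground M" using c C(2) assms(1) ground_eq by auto
    have "insert c (X - {c}) = X" using c C(2) by auto
    then have "c \<in> cl (X - {c})" using clI[OF indep order_refl \<open>c \<in> ground M\<close>] assms(2) by simp
    then have "e0 \<in> cl (X - {c})"
      using cl_trans[of e0 c "X - {c}"] e0 \<open>insert c (X - {c}) = X\<close> sub ground_eq by auto
    then show False using indep_insertD[OF True] e0_new sub by blast
  next
    case False
    then obtain D where D: "D \<in> cycles G" "D \<subseteq> X - {c}" using forest[OF sub] by blast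
    have unb: "C \<in> unbalanced_cycles \<Gamma> LG_label G" "D \<in> unbalanced_cycles \<Gamma> LG_label G"
      using bal C D by auto
    have CD: "C \<union> D \<subseteq> X" using C(2) D(2) by blast
    consider "ends G C \<inter> ends G D = {}" | v where "ends G C \<inter> ends G D = {v}" |
      a b where "a \<noteq> b" "a \<in> ends G C \<inter> ends G D" "b \<in> ends G C \<inter> ends G D"
      by (metis (no_types, lifting) is_singletonI' is_singleton_def)
    then show False
    proof cases
      case 1
      then have "C \<union> D \<in> lift_circuits \<Gamma> LG_label G"
        unfolding lift_circuits_def using unb by blast
      then show ?thesis using no CD by blast
    next
      case 2
      then have "C \<union> D \<in> lift_circuits \<Gamma> LG_label G"
        unfolding lift_circuits_def using unb by blast
      then show ?thesis using no CD by blast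
    next
      case 3
      \<comment> \<open>The roles of the cycles are exchanged: \<open>c\<close> lies on
        \<open>C\<close> but not on \<open>D\<close>, so the ear is cut from
        \<open>C\<close>.\<close>
      then obtain T where T: "T \<in> thetas G" "T \<subseteq> D \<union> C"
        using theta_in_union[OF D(1) C(1) c, of a b] D(2) by blast
      then have "T \<subseteq> X" using CD by blast
      then have "\<forall>C\<in>cycles G. C \<subseteq> T \<longrightarrow> C \<in> unbalanced_cycles \<Gamma> LG_label G"
        using bal by (meson order_trans)
      then have "T \<in> lift_circuits \<Gamma> LG_label G"
        unfolding lift_circuits_def using T(1) by simp
      then show ?thesis using no \<open>T \<subseteq> X\<close> by blast
    qed
  qed
qed

lemma is_LG_plus: "is_LG_plus k \<Gamma> M"
  unfolding is_LG_plus_def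
proof (intro conjI exI[of _ e0])
  have LG_ground: "ground (LG k \<Gamma>) = arcs G" by (simp add: LG_def matroid_of_circuits_def)
  show "matroid M" by (rule matroid_axioms)
  show "e0 \<notin> ground (LG k \<Gamma>)" "ground M = insert e0 (ground (LG k \<Gamma>))"
    unfolding LG_ground by (rule e0_new) (rule ground_eq)
  have rest: "ground M - {e0} = arcs G" using e0_new ground_eq by blast
  have "I \<in> indeps M \<longleftrightarrow> \<not> (\<exists>C\<in>lift_circuits \<Gamma> LG_label G. C \<subseteq> I)" if "I \<subseteq> arcs G" for I
    using that lift_circuit_dependent dependent_contains_lift_circuit indeps_down by metis
  then show "deletion M {e0} = LG k \<Gamma>"
    unfolding deletion_def restriction_def rest LG_def matroid_of_circuits_def
    using ground_eq by auto
  have "{e0} \<in> indeps M"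
    using forest[of "{}"] has_cycle_iff[of "{}"] by simp
  then have "basis_of M {e0} B \<longleftrightarrow> B = {e0}" for B
    unfolding basis_of_def by auto
  then show "contraction M {e0} = cycle_matroid (LG_graph k \<Gamma>)"
    unfolding contraction_def rest cycle_matroid_def matroid_of_circuits_def
    using forest by auto
qed

end

section \<open>Coordinatizing triangle systems\<close>

text \<open>As \<open>bal\<close> is a predicate on sets, a triangle has no preferred vertex, and
  \<open>fourth_triangle\<close> may be applied with any vertex of a K4 as apex.\<close>

locale triangle_system =
  fixes P :: "nat \<Rightarrow> nat \<Rightarrow> 'a set" and bal :: "'a set \<Rightarrow> bool" and n t :: nat
  assumes n: "4 \<le> n" and t: "0 < t"
    and P_sym: "P u v = P v u"
    and P_card: "u < n \<Longrightarrow> v < n \<Longrightarrow> u \<noteq> v \<Longrightarrow> card (P u v) = t"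
    and completion: "distinct [u, v, w] \<Longrightarrow> {u, v, w} \<subseteq> {..<n} \<Longrightarrow> a \<in> P u v \<Longrightarrow> b \<in> P v w \<Longrightarrow>
      \<exists>!c. c \<in> P u w \<and> bal {a, b, c}"
    and fourth_triangle: "distinct [u, v, w, z] \<Longrightarrow> {u, v, w, z} \<subseteq> {..<n} \<Longrightarrow>
      a \<in> P u v \<Longrightarrow> b \<in> P u w \<Longrightarrow> c \<in> P u z \<Longrightarrow> d \<in> P v w \<Longrightarrow> e \<in> P v z \<Longrightarrow> f \<in> P w z \<Longrightarrow>
      bal {a, b, d} \<Longrightarrow> bal {a, c, e} \<Longrightarrow> bal {b, c, f} \<Longrightarrow> bal {d, e, f}"
begin

definition comp :: "nat \<Rightarrow> nat \<Rightarrow> nat \<Rightarrow> 'a \<Rightarrow> 'a \<Rightarrow> 'a" where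
  "comp u v w a b = (THE c. c \<in> P u w \<and> bal {a, b, c})"

lemma comp:
  assumes "distinct [u, v, w]" "{u, v, w} \<subseteq> {..<n}" "a \<in> P u v" "b \<in> P v w"
  shows "comp u v w a b \<in> P u w" "bal {a, b, comp u v w a b}"
  using theI'[OF completion[OF assms]] by (simp_all add: comp_def)

lemma completion_unique:
  assumes "distinct [u, v, w]" "{u, v, w} \<subseteq> {..<n}" "a \<in> P u v" "b \<in> P v w"
    and "c \<in> P u w" "bal {a, b, c}" "c' \<in> P u w" "bal {a, b, c'}"
  shows "c = c'"
  using completion[OF assms(1-4)] assms(5-) by blast

text \<open>Completing over another side of the same triangle recovers \<open>\<beta> g\<close>,
  which gives injectivity; equal class sizes give the rest.\<close>

lemma comp_bij:
  assumes "distinct [u, v, w]" "{u, v, w} \<subseteq> {..<n}" "a \<in> P u v"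
    and \<beta>: "bij_betw \<beta> {..<t} (P v w)"
  shows "bij_betw (\<lambda>g. comp u v w a (\<beta> g)) {..<t} (P u w)"
proof -
  let ?f = "\<lambda>g. comp u v w a (\<beta> g)"
  have mem: "\<beta> g \<in> P v w" if "g < t" for g using \<beta> that by (auto simp: bij_betw_def)
  have c: "?f g \<in> P u w" "bal {a, \<beta> g, ?f g}" if "g < t" for g
    using comp[OF assms(1-3) mem[OF that]] by simp_all
  have inj: "inj_on ?f {..<t}"
  proof (rule inj_onI)
    fix g h assume gh: "g \<in> {..<t}" "h \<in> {..<t}" and eq: "?f g = ?f h"
    have "\<beta> g = \<beta> h"
    proof (rule completion_unique)
      show "distinct [v, u, w]" "{v, u, w} \<subseteq> {..<n}" using assms(1,2) by auto
      show "a \<in> P v u" "?f g \<in> P u w" "\<beta> g \<in> P v w" "\<beta> h \<in> P v w"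
        using assms(3) P_sym[of u v] c(1) mem gh by auto
      show "bal {a, ?f g, \<beta> g}" using c(2) gh by (simp add: insert_commute)
      show "bal {a, ?f g, \<beta> h}" unfolding eq using c(2) gh by (simp add: insert_commute)
    qed
    then show "g = h" using \<beta> gh by (auto simp: bij_betw_def dest: inj_onD)
  qed
  have card: "card (P u w) = t" using P_card[of u w] assms(1,2) by simp
  then have "finite (P u w)" using t card.infinite by fastforce
  moreover have "?f ` {..<t} \<subseteq> P u w" using c(1) by auto
  ultimately have "?f ` {..<t} = P u w"
    using card by (metis card_image card_lessThan card_subset_eq inj)
  then show ?thesis using inj by (simp add: bij_betw_def)
qed

text \<open>
  Labels are the numbers below \<open>t\<close>, with 0 as the identity.  An arbitrary labelling \<open>\<beta> 1\<close> of
  \<open>P 0 1\<close> is carried by \<open>\<tau>\<close> to every \<open>P 0 v\<close> through the element of \<open>P 1 v\<close> that balances the base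
  elements \<open>\<beta> 1 0\<close> and \<open>\<beta> v 0\<close>; that element receives the label 0.
\<close>

definition \<beta> :: "nat \<Rightarrow> nat \<Rightarrow> 'a" where
  "\<beta> v = (SOME f. bij_betw f {..<t} (P 0 v))"

definition \<tau> :: "nat \<Rightarrow> nat \<Rightarrow> 'a" where
  "\<tau> v g = (if v = 1 then \<beta> 1 g else comp v 1 0 (comp v 0 1 (\<beta> v 0) (\<beta> 1 0)) (\<beta> 1 g))"

text \<open>For positive \<open>u\<close> the completion is chosen so that 0 is a left identity in
  all triangles at vertex 0.\<close>

definition L :: "nat \<Rightarrow> nat \<Rightarrow> nat \<Rightarrow> 'a" where
  "L u v g = (if u = 0 then \<tau> v g else comp u 0 v (\<tau> u 0) (\<tau> v g))"

lemma \<beta>_bij: "0 < v \<Longrightarrow> v < n \<Longrightarrow> bij_betw (\<beta> v) {..<t} (P 0 v)"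
proof -
  assume "0 < v" "v < n"
  then have "card (P 0 v) = t" using P_card by simp
  then have "finite (P 0 v)" using t card.infinite by fastforce
  then have "\<exists>f. bij_betw f {..<t} (P 0 v)"
    using \<open>card (P 0 v) = t\<close> by (intro finite_same_card_bij) simp_all
  then show ?thesis unfolding \<beta>_def by (rule someI_ex)
qed

lemma \<beta>_mem: "0 < v \<Longrightarrow> v < n \<Longrightarrow> g < t \<Longrightarrow> \<beta> v g \<in> P 0 v"
  using \<beta>_bij by (auto simp: bij_betw_def)

lemma \<tau>_bij:
  assumes "0 < v" "v < n"
  shows "bij_betw (\<tau> v) {..<t} (P 0 v)"
proof (cases "v = 1")
  case True
  then show ?thesis using \<beta>_bij[OF assms] by (simp add: \<tau>_def[abs_def])
next
  case False
  have "comp v 0 1 (\<beta> v 0) (\<beta> 1 0) \<in> P v 1"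
    using comp[of v 0 1] \<beta>_mem[of v 0] \<beta>_mem[of 1 0] assms False n t P_sym[of 0 v] by simp
  then have "bij_betw (\<lambda>g. comp v 1 0 (comp v 0 1 (\<beta> v 0) (\<beta> 1 0)) (\<beta> 1 g)) {..<t} (P v 0)"
    using comp_bij[of v 1 0] \<beta>_bij[of 1] assms False n P_sym[of 0 1] by simp
  then show ?thesis using False P_sym[of 0 v] by (simp add: \<tau>_def[abs_def])
qed

lemma \<tau>_mem: "0 < v \<Longrightarrow> v < n \<Longrightarrow> g < t \<Longrightarrow> \<tau> v g \<in> P 0 v"
  using \<tau>_bij by (auto simp: bij_betw_def)

lemma \<tau>_0:
  assumes "0 < v" "v < n"
  shows "\<tau> v 0 = \<beta> v 0"
proof (cases "v = 1")
  case False
  let ?E = "comp v 0 1 (\<beta> v 0) (\<beta> 1 0)"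
  have E: "?E \<in> P v 1" "bal {\<beta> v 0, \<beta> 1 0, ?E}"
    using comp[of v 0 1] \<beta>_mem[of v 0] \<beta>_mem[of 1 0] assms False n t P_sym[of 0 v] by simp_all
  have "comp v 1 0 ?E (\<beta> 1 0) \<in> P v 0" "bal {?E, \<beta> 1 0, comp v 1 0 ?E (\<beta> 1 0)}"
    using comp[of v 1 0] E(1) \<beta>_mem[of 1 0] assms False n t P_sym[of 0 1] by simp_all
  then have "comp v 1 0 ?E (\<beta> 1 0) = \<beta> v 0"
    using completion_unique[of v 1 0 ?E "\<beta> 1 0"] E \<beta>_mem[of v 0] \<beta>_mem[of 1 0] assms False n t
      P_sym[of 0 1] P_sym[of 0 v] by (simp add: insert_commute)
  then show ?thesis using False by (simp add: \<tau>_def)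
qed (simp add: \<tau>_def)

lemma L_bij:
  assumes "u < v" "v < n"
  shows "bij_betw (L u v) {..<t} (P u v)"
proof (cases "u = 0")
  case True
  then show ?thesis using \<tau>_bij[of v] assms by (simp add: L_def[abs_def])
next
  case False
  have "\<tau> u 0 \<in> P u 0" using \<tau>_mem[of u 0] P_sym[of 0 u] assms False t by simp
  then have "bij_betw (\<lambda>g. comp u 0 v (\<tau> u 0) (\<tau> v g)) {..<t} (P u v)"
    using comp_bij[of u 0 v] \<tau>_bij[of v] assms False n by simp
  then show ?thesis using False by (simp add: L_def[abs_def])
qed

lemma L_mem: "u < v \<Longrightarrow> v < n \<Longrightarrow> g < t \<Longrightarrow> L u v g \<in> P u v"
  using L_bij by (auto simp: bij_betw_def)

lemma triangle_zero_left:
  assumes "0 < u" "u < v" "v < n" "g < t"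
  shows "bal {L 0 u 0, L u v g, L 0 v g}"
  using comp(2)[of u 0 v "\<tau> u 0" "\<tau> v g"] \<tau>_mem[of u 0] \<tau>_mem[of v g] P_sym[of 0 u] assms t
  by (simp add: L_def insert_commute)

lemma triangle_zero_left':
  "0 < u \<Longrightarrow> u < v \<Longrightarrow> v < n \<Longrightarrow> g < t \<Longrightarrow> bal {L 0 u 0, L 0 v g, L u v g}"
  using triangle_zero_left[of u v g] by (simp add: insert_commute)

text \<open>The purpose of \<open>\<tau>\<close>: its auxiliary element turns out to be
  \<open>L 1 v 0\<close>, so 0 is also a right identity when the middle vertex is 1.\<close>

lemma triangle_one_right:
  assumes "1 < v" "v < n" "g < t"
  shows "bal {L 0 1 g, L 1 v 0, L 0 v g}"
proof -
  let ?E = "comp v 0 1 (\<beta> v 0) (\<beta> 1 0)"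
  have E: "?E \<in> P v 1" "bal {\<beta> v 0, \<beta> 1 0, ?E}"
    using comp[of v 0 1] \<beta>_mem[of v 0] \<beta>_mem[of 1 0] assms n t P_sym[of 0 v] by simp_all
  have L1: "L 1 v 0 \<in> P 1 v" "bal {\<tau> 1 0, \<tau> v 0, L 1 v 0}"
    using L_mem[of 1 v 0] triangle_zero_left[of 1 v 0] assms t by (simp_all add: L_def insert_commute)
  have "L 1 v 0 = ?E"
    using completion_unique[of 1 0 v "\<beta> 1 0" "\<beta> v 0"] E L1 \<tau>_0[of 1] \<tau>_0[of v]
      \<beta>_mem[of v 0] \<beta>_mem[of 1 0] assms n t P_sym[of 0 1] P_sym[of v 1]
    by (simp add: insert_commute)
  moreover have "bal {?E, \<beta> 1 g, \<tau> v g}"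
    using comp(2)[of v 1 0 ?E "\<beta> 1 g"] E(1) \<beta>_mem[of 1 g] assms n P_sym[of 0 1]
    by (simp add: \<tau>_def)
  ultimately show ?thesis by (simp add: L_def \<tau>_def insert_commute)
qed

text \<open>The right identity spreads from middle vertex 1 to \<open>u\<close> inside the K4 on 0,
  1, \<open>u\<close>, \<open>v\<close>. Apex 0 shows that the triangle 1, \<open>u\<close>,
  \<open>v\<close> with all labels 0 is balanced; apex 1 then yields the triangle 0,
  \<open>u\<close>, \<open>v\<close>.\<close>

lemma triangle_zero_right:
  assumes "0 < u" "u < v" "v < n" "g < t"
  shows "bal {L 0 u g, L u v 0, L 0 v g}"
proof (cases "u = 1")
  case True
  then show ?thesis using triangle_one_right assms by simp
next
  case False
  then have u: "1 < u" using assms by simp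
  have L10: "L 0 1 h \<in> P 1 0" if "h < t" for h using L_mem[of 0 1 h] that P_sym[of 0 1] n by simp
  have base: "bal {L 1 u 0, L 1 v 0, L u v 0}"
    by (rule fourth_triangle[of 0 1 u v "L 0 1 0" "L 0 u 0" "L 0 v 0"])
      (use assms u n t L_mem triangle_zero_left' in auto)
  have "bal {L 0 u g, L 0 v g, L u v 0}"
    by (rule fourth_triangle[of 1 0 u v "L 0 1 g" "L 1 u 0" "L 1 v 0"])
      (use base assms u n t L_mem L10 triangle_one_right in auto)
  then show ?thesis by (simp add: insert_commute)
qed

section \<open>Multiplications defined by the triangles at vertex 0\<close>

definition mul :: "nat \<Rightarrow> nat \<Rightarrow> nat \<Rightarrow> nat \<Rightarrow> nat" where
  "mul u v g h = the_inv_into {..<t} (L 0 v) (comp 0 u v (L 0 u g) (L u v h))"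

lemma mul:
  assumes "0 < u" "u < v" "v < n" "g < t" "h < t"
  shows "mul u v g h < t" "bal {L 0 u g, L u v h, L 0 v (mul u v g h)}"
proof -
  let ?c = "comp 0 u v (L 0 u g) (L u v h)"
  have c: "?c \<in> P 0 v" "bal {L 0 u g, L u v h, ?c}"
    using comp[of 0 u v "L 0 u g" "L u v h"] L_mem assms by simp_all
  have bij: "bij_betw (L 0 v) {..<t} (P 0 v)" using L_bij assms by simp
  then have img: "?c \<in> L 0 v ` {..<t}" "inj_on (L 0 v) {..<t}" using c(1) by (auto simp: bij_betw_def)
  then show "mul u v g h < t"
    using the_inv_into_into[OF img(2,1) order_refl] by (simp add: mul_def)
  show "bal {L 0 u g, L u v h, L 0 v (mul u v g h)}"
    using c(2) f_the_inv_into_f[OF img(2,1)] by (simp add: mul_def)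
qed

lemma mul_unique:
  assumes "0 < u" "u < v" "v < n" "g < t" "h < t" "k < t" "bal {L 0 u g, L u v h, L 0 v k}"
  shows "mul u v g h = k"
proof -
  have "L 0 v (mul u v g h) = L 0 v k"
    by (rule completion_unique[of 0 u v "L 0 u g" "L u v h"])
      (use assms L_mem mul[OF assms(1-5)] in auto)
  then show ?thesis
    using L_bij[of 0 v] mul(1)[OF assms(1-5)] assms by (auto simp: bij_betw_def dest: inj_onD)
qed

lemma mul_zero:
  assumes "0 < u" "u < v" "v < n" "g < t"
  shows "mul u v 0 g = g" "mul u v g 0 = g"
  using mul_unique triangle_zero_left triangle_zero_right assms t by simp_all

text \<open>Through the base element \<open>L 0 u 0\<close>, an edge at \<open>u\<close> carries the
  same label as the corresponding edge at 0. Apex 0 therefore moves the triangle 0,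
  \<open>v\<close>, \<open>w\<close> to \<open>u\<close>, \<open>v\<close>,
  \<open>w\<close>.\<close>

lemma triangle_pos:
  assumes "0 < u" "u < v" "v < w" "w < n" "g < t" "h < t"
  shows "bal {L u v g, L v w h, L u w (mul v w g h)}"
proof -
  have m: "mul v w g h < t" "bal {L 0 v g, L 0 w (mul v w g h), L v w h}"
    using mul[of v w g h] assms by (simp_all add: insert_commute)
  have "bal {L u v g, L u w (mul v w g h), L v w h}"
    by (rule fourth_triangle[of 0 u v w "L 0 u 0" "L 0 v g" "L 0 w (mul v w g h)"])
      (use assms t m L_mem triangle_zero_left' in auto)
  then show ?thesis by (simp add: insert_commute)
qed

text \<open>
  Setting \<open>g\<close> or \<open>h\<close> to the identity 0 here shows that all the multiplications \<open>mul u v\<close> agree; this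
  needs three vertices besides 0, that is, \<open>n \<ge> 4\<close>.
\<close>

lemma mul_mixed_assoc:
  assumes "0 < u" "u < v" "v < w" "w < n" "a < t" "g < t" "h < t"
  shows "mul v w (mul u v a g) h = mul u w a (mul v w g h)"
proof -
  let ?b = "mul u v a g" and ?m = "mul v w g h" and ?q = "mul v w (mul u v a g) h"
  have b: "?b < t" "bal {L 0 u a, L u v g, L 0 v ?b}" using mul assms by simp_all
  have m: "?m < t" using mul assms by simp
  have q: "?q < t" "bal {L 0 v ?b, L v w h, L 0 w ?q}" using mul assms b(1) by simp_all
  have mem: "L 0 v ?b \<in> P v 0" "L u v g \<in> P v u"
    using L_mem[of 0 v ?b] L_mem[of u v g] P_sym[of 0 v] P_sym[of u v] assms b by simp_all
  \<comment> \<open>Apex \<open>v\<close>: the triangles of the two left-hand products and the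
    triangle \<open>u\<close>, \<open>v\<close>, \<open>w\<close> are balanced; the remaining
    triangle 0, \<open>u\<close>, \<open>w\<close> evaluates the right-hand side.\<close>
  have "bal {L 0 u a, L 0 w ?q, L u w ?m}"
    by (rule fourth_triangle[of v 0 u w "L 0 v ?b" "L u v g" "L v w h"])
      (use assms b m q mem L_mem triangle_pos in \<open>auto simp: insert_commute\<close>)
  then have "bal {L 0 u a, L u w ?m, L 0 w ?q}" by (simp add: insert_commute)
  then show ?thesis using mul_unique[of u w a ?m ?q] assms m q(1) by simp
qed

lemma mul_eq:
  assumes "0 < u" "u < v" "v < n" "g < t" "h < t"
  shows "mul u v g h = mul 1 2 g h"
proof -
  have "mul u v g h = mul 1 v g h"
    using mul_mixed_assoc[of 1 u v g 0 h] mul_zero assms t by (cases "u = 1") simp_all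
  also have "\<dots> = mul 1 2 g h"
    using mul_mixed_assoc[of 1 2 v g h 0] mul_zero mul(1) assms t by (cases "v = 2") simp_all
  finally show ?thesis .
qed

text \<open>In the triangle 0, 1, 2 the sides with product 0 and right factor \<open>g\<close> are
  given; completing it yields the left factor.\<close>

lemma mul_left_inverse:
  assumes "g < t"
  obtains h where "h < t" "mul 1 2 h g = 0"
proof -
  have mem: "L 0 2 0 \<in> P 0 2" "L 1 2 g \<in> P 2 1"
    using L_mem[of 0 2 0] L_mem[of 1 2 g] P_sym[of 2 1] n t assms by simp_all
  then obtain c where c: "c \<in> P 0 1" "bal {L 0 2 0, L 1 2 g, c}"
    using comp[of 0 2 1 "L 0 2 0" "L 1 2 g"] n by auto
  then obtain h where "h < t" "c = L 0 1 h"
    using L_bij[of 0 1] n by (auto simp: bij_betw_def)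
  then show thesis
    using that[of h] mul_unique[of 1 2 h g 0] c(2) n t assms by (simp add: insert_commute)
qed

theorem coordinatization:
  obtains \<Gamma> :: "nat monoid" and \<Lambda> where "group \<Gamma>" "carrier \<Gamma> = {..<t}"
    "\<And>u v. u < v \<Longrightarrow> v < n \<Longrightarrow> bij_betw (\<Lambda> u v) {..<t} (P u v)"
    "\<And>i j l g h. i < j \<Longrightarrow> j < l \<Longrightarrow> l < n \<Longrightarrow> g < t \<Longrightarrow> h < t \<Longrightarrow>
      bal {\<Lambda> i j g, \<Lambda> j l h, \<Lambda> i l (g \<otimes>\<^bsub>\<Gamma>\<^esub> h)}"
proof -
  let ?\<Gamma> = "\<lparr>carrier = {..<t}, mult = mul 1 2, one = 0\<rparr> :: nat monoid"
  have "group ?\<Gamma>"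
  proof (rule groupI)
    show "x \<otimes>\<^bsub>?\<Gamma>\<^esub> y \<in> carrier ?\<Gamma>" if "x \<in> carrier ?\<Gamma>" "y \<in> carrier ?\<Gamma>" for x y
      using that mul(1)[of 1 2] n by simp
    show "x \<otimes>\<^bsub>?\<Gamma>\<^esub> y \<otimes>\<^bsub>?\<Gamma>\<^esub> z = x \<otimes>\<^bsub>?\<Gamma>\<^esub> (y \<otimes>\<^bsub>?\<Gamma>\<^esub> z)"
      if "x \<in> carrier ?\<Gamma>" "y \<in> carrier ?\<Gamma>" "z \<in> carrier ?\<Gamma>" for x y z
      \<comment> \<open>The vertices 0, 1, 2, 3 exist because \<open>4 \<le> n\<close>.\<close>
      using that mul_mixed_assoc[of 1 2 3 x y z] mul_eq[of 2 3] mul_eq[of 1 3] mul(1)[of 1 2] n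
      by simp
    show "\<exists>y\<in>carrier ?\<Gamma>. y \<otimes>\<^bsub>?\<Gamma>\<^esub> x = \<one>\<^bsub>?\<Gamma>\<^esub>" if "x \<in> carrier ?\<Gamma>" for x
    proof -
      from that obtain y where "y < t" "mul 1 2 y x = 0" by (auto intro: mul_left_inverse)
      then show ?thesis by auto
    qed
  qed (use mul_zero[of 1 2] n t in auto)
  moreover have "bal {L i j g, L j l h, L i l (mul 1 2 g h)}"
    if "i < j" "j < l" "l < n" "g < t" "h < t" for i j l g h
  proof -
    \<comment> \<open>Triangles at 0 and triangles away from 0 are both governed by the
      multiplication of their two larger vertices.\<close>
    have "mul 1 2 g h = mul j l g h" using mul_eq[of j l] that by simp
    then show ?thesis using mul(2)[of j l g h] triangle_pos[of i j l g h] that by (cases "i = 0") simp_all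
  qed
  ultimately show thesis using that[of ?\<Gamma> L] L_bij by simp
qed

end

section \<open>From the matroid to the triangle system\<close>

lemma complete_graph_simps [simp]:
  "verts (complete_graph n) = {..<n}"
  "arcs (complete_graph n) = {(i, j). i < j \<and> j < n}"
  "tail (complete_graph n) = fst"
  "head (complete_graph n) = snd"
  by (simp_all add: complete_graph_def)

lemma wf_complete_graph: "wf_digraph (complete_graph n)"
  by unfold_locales auto

definition edge_ends :: "nat \<times> nat \<times> 'g \<Rightarrow> nat \<times> nat" where
  "edge_ends e = (fst e, fst (snd e))"

text \<open>Reachability sees only the ends of edges, so cycles descend to the simple graph unless
  two edges are parallel, in which case they form a digon.\<close>

lemma LG_graph_has_cycle_iff:
  assumes "Y \<subseteq> arcs (LG_graph n \<Gamma>)"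
  shows "(\<exists>C\<in>cycles (LG_graph n \<Gamma>). C \<subseteq> Y) \<longleftrightarrow>
    \<not> inj_on edge_ends Y \<or> (\<exists>C\<in>cycles (complete_graph n). C \<subseteq> edge_ends ` Y)"
proof -
  let ?G = "LG_graph n \<Gamma>" and ?K = "complete_graph n"
  interpret G: wf_digraph ?G by (rule wf_LG_graph)
  interpret K: wf_digraph ?K by (rule wf_complete_graph)
  have ends: "tail ?G e = fst (edge_ends e)" "head ?G e = snd (edge_ends e)" for e
    by (cases e; simp add: edge_ends_def)+
  have joined: "joined ?G Z u v \<longleftrightarrow> joined ?K (edge_ends ` Z) u v" for Z u v
    by (simp add: joined_def adj_rel_def ends)
  have arcs: "edge_ends ` Y \<subseteq> arcs ?K" using assms by (auto simp: edge_ends_def)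
  show ?thesis
  proof (cases "inj_on edge_ends Y")
    case True
    then have "edge_ends ` (Y - {e}) = edge_ends ` Y - {edge_ends e}" if "e \<in> Y" for e
      using that by (auto dest: inj_onD)
    then show ?thesis
      using True unfolding G.has_cycle_iff[OF assms] K.has_cycle_iff[OF arcs] joined
      by (simp add: ends)
  next
    case False
    then obtain e f where ef: "e \<in> Y" "f \<in> Y" "e \<noteq> f" "edge_ends e = edge_ends f"
      unfolding inj_on_def by blast
    then have "joined ?G (Y - {e}) (tail ?G e) (head ?G e)"
      using joined_edge[of f "Y - {e}" ?G] by (simp add: ends)
    then show ?thesis using G.has_cycle_iff[OF assms] ef(1) False by blast
  qed
qed

section \<open>Parallel classes of the contraction of \<open>x\<close>\<close>

locale simple_contraction = matroid M for M :: "'a indep_structure" +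
  fixes x :: 'a
  assumes simple: "simple_matroid M" and x: "x \<in> ground M"
begin

abbreviation E where "E \<equiv> ground M - {x}"

abbreviation R where "R \<equiv> parallel_rel (contraction M {x})"

lemma pair_indep: "e \<in> ground M \<Longrightarrow> f \<in> ground M \<Longrightarrow> {e, f} \<in> indeps M"
  using simple_pair_indep[OF simple] .

lemma contraction_indep:
  "e \<in> ground M \<Longrightarrow> I \<in> indeps (contraction M {e}) \<longleftrightarrow> I \<subseteq> ground M - {e} \<and> insert e I \<in> indeps M"
  using contraction_indep_iff[of e I] pair_indep[of e e] by simp

lemma no_loops: "loops (contraction M {x}) = {}"
  using contraction_indep[OF x] pair_indep[OF x] by (auto simp: loops_def circuits_def)

lemma parallel_rel_eq: "R = {(e, f). e \<in> E \<and> f \<in> E \<and> f \<in> cl {x, e}}"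
proof -
  have "e = f \<or> parallel (contraction M {x}) e f \<longleftrightarrow> f \<in> cl {x, e}" if e: "e \<in> E" and f: "f \<in> E" for e f
  proof -
    have "D \<in> indeps (contraction M {x})" if "D \<subset> {e, f}" for D
    proof -
      have "insert x D \<subseteq> {x, e} \<or> insert x D \<subseteq> {x, f}" using that by blast
      then have "insert x D \<in> indeps M" using indeps_down pair_indep x e f by (metis DiffD1)
      then show ?thesis using that e f contraction_indep[OF x] by auto
    qed
    then have "parallel (contraction M {x}) e f \<longleftrightarrow> e \<noteq> f \<and> insert x {e, f} \<notin> indeps M"
      using e f contraction_indep[OF x, of "{e, f}"] by (auto simp: parallel_def circuits_def)
    moreover have "f \<in> cl {x, e} \<longleftrightarrow> f = e \<or> insert f {x, e} \<notin> indeps M"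
      using cl_indep_iff[OF pair_indep[OF x]] e f by auto
    ultimately show ?thesis by (auto simp: insert_commute)
  qed
  then show ?thesis unfolding parallel_rel_def no_loops by auto
qed

lemma parallel_equiv: "equiv E R"
proof (rule equivI)
  show "R \<subseteq> E \<times> E" by (auto simp: parallel_rel_eq)
  show "refl_on E R" using subset_cl[of "{x, _}"] x by (auto simp: refl_on_def parallel_rel_eq)
  show "sym R" by (auto simp: sym_def parallel_rel_def parallel_def insert_commute)
  show "trans R"
  proof (rule transI)
    fix e f g assume "(e, f) \<in> R" "(f, g) \<in> R"
    then have *: "e \<in> E" "g \<in> E" "f \<in> cl {x, e}" "g \<in> cl {x, f}" by (auto simp: parallel_rel_eq)
    have sub: "{x, e} \<subseteq> ground M" using * x by simp
    then have "{x, f} \<subseteq> cl {x, e}" using *(3) subset_cl[OF sub] by simp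
    then show "(e, g) \<in> R" using in_cl_trans[OF *(4) _ sub] * by (simp add: parallel_rel_eq)
  qed
qed

text \<open>The same choice as in \<open>si\<close>, so that the ground set of the simplification is
  literally the image of \<open>rep\<close>.\<close>

definition rep :: "'a \<Rightarrow> 'a" where
  "rep e = (SOME y. y \<in> R `` {e})"

lemma rep: "e \<in> E \<Longrightarrow> (e, rep e) \<in> R"
  using equiv_class_self[OF parallel_equiv] someI[of "\<lambda>y. y \<in> R `` {e}" e] by (auto simp: rep_def)

lemma rep_eq_iff: "e \<in> E \<Longrightarrow> f \<in> E \<Longrightarrow> rep e = rep f \<longleftrightarrow> (e, f) \<in> R"
proof
  assume ef: "e \<in> E" "f \<in> E" "rep e = rep f"
  then have "(e, rep e) \<in> R" "(rep e, f) \<in> R"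
    using rep[of e] rep[of f] parallel_equiv unfolding equiv_def sym_def by auto
  then show "(e, f) \<in> R" using parallel_equiv unfolding equiv_def trans_def by blast
next
  assume "(e, f) \<in> R"
  then have "R `` {e} = R `` {f}" by (rule equiv_class_eq[OF parallel_equiv])
  then show "rep e = rep f" by (simp add: rep_def)
qed

lemma rep_E: "rep ` E \<subseteq> E"
  using rep by (auto simp: parallel_rel_eq)

lemma si_eq: "si (contraction M {x}) = restriction (contraction M {x}) (rep ` E)"
proof -
  have "parallel_classes (contraction M {x}) = (\<lambda>e. R `` {e}) ` E"
    unfolding parallel_classes_def no_loops by (auto simp: quotient_def)
  then have "(\<lambda>P. SOME e. e \<in> P) ` parallel_classes (contraction M {x}) = rep ` E"
    unfolding rep_def by (simp only: image_image)
  then show ?thesis by (simp only: si_def)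
qed

lemma si_ground: "ground (si (contraction M {x})) = rep ` E"
  unfolding si_eq using rep_E by (auto simp: restriction_def)

lemma si_indeps: "X \<subseteq> rep ` E \<Longrightarrow> X \<in> indeps (si (contraction M {x})) \<longleftrightarrow> insert x X \<in> indeps M"
  unfolding si_eq using rep_E contraction_indep[OF x, of X] by (auto simp: restriction_def)

lemma parallel_dep:
  assumes "(e, f) \<in> R" "e \<noteq> f"
  shows "{x, e, f} \<notin> indeps M"
proof -
  have "f \<in> cl {x, e}" "f \<notin> {x, e}" "{x, e} \<in> indeps M" "f \<in> ground M"
    using assms pair_indep x by (auto simp: parallel_rel_eq)
  then show ?thesis using cl_indep_iff[of "{x, e}" f] by (simp add: insert_commute)
qed

lemma rep_cl: "e \<in> E \<Longrightarrow> rep e \<in> cl {x, e}" "e \<in> E \<Longrightarrow> e \<in> cl {x, rep e}"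
proof -
  assume e: "e \<in> E"
  then have "(e, rep e) \<in> R" "(rep e, e) \<in> R"
    using rep parallel_equiv by (auto simp: equiv_def sym_def)
  then show "rep e \<in> cl {x, e}" "e \<in> cl {x, rep e}" by (auto simp: parallel_rel_eq)
qed

text \<open>Together with \<open>x\<close>, an element and its representative span each other. Hence
  both sets have the same closure, and only their sizes need comparing.\<close>

lemma indep_rep_iff:
  assumes Y: "Y \<subseteq> E"
  shows "insert x Y \<in> indeps M \<longleftrightarrow> inj_on rep Y \<and> insert x (rep ` Y) \<in> indeps M"
proof -
  have sub: "insert x Y \<subseteq> ground M" "insert x (rep ` Y) \<subseteq> ground M" using Y x rep_E by auto
  have fin: "finite Y" using sub(1) finite_ground by (meson finite_insert finite_subset)
  have new: "x \<notin> Y" "x \<notin> rep ` Y" using Y rep_E by auto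
  have span: "insert x Y \<subseteq> cl (insert x (rep ` Y))" "insert x (rep ` Y) \<subseteq> cl (insert x Y)"
  proof -
    have "e \<in> cl (insert x (rep ` Y))" "rep e \<in> cl (insert x Y)" if "e \<in> Y" for e
      using that rep_cl[of e] Y cl_mono[of "{x, rep e}" "insert x (rep ` Y)"]
        cl_mono[of "{x, e}" "insert x Y"] by auto
    then show "insert x Y \<subseteq> cl (insert x (rep ` Y))" "insert x (rep ` Y) \<subseteq> cl (insert x Y)"
      using subset_cl[OF sub(1)] subset_cl[OF sub(2)] by auto
  qed
  show ?thesis
  proof
    assume indep: "insert x Y \<in> indeps M"
    have "inj_on rep Y"
    proof (rule inj_onI)
      fix e f assume ef: "e \<in> Y" "f \<in> Y" "rep e = rep f"
      then have "(e, f) \<in> R" using rep_eq_iff Y by blast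
      moreover have "{x, e, f} \<in> indeps M" using indeps_down[OF indep] ef by simp
      ultimately show "e = f" using parallel_dep by blast
    qed
    moreover have "card (insert x (rep ` Y)) \<le> card (insert x Y)"
      using fin new by (simp add: card_image_le)
    ultimately show "inj_on rep Y \<and> insert x (rep ` Y) \<in> indeps M"
      using spanning_indep[OF indep span(1) sub(2)] by simp
  next
    assume *: "inj_on rep Y \<and> insert x (rep ` Y) \<in> indeps M"
    then have "card (insert x Y) \<le> card (insert x (rep ` Y))"
      using fin new by (simp add: card_image)
    then show "insert x Y \<in> indeps M" using spanning_indep[OF _ span(2) sub(1)] * by simp
  qed
qed

text \<open>Representatives and the isomorphism merge into one map from elements to edges; from here
  on only its fibres matter.\<close>

lemma projection:
  assumes iso: "matroid_iso (si (contraction M {x})) (cycle_matroid K)"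
    and card: "\<forall>P\<in>parallel_classes (contraction M {x}). card P = t"
  obtains \<pi> where "\<pi> ` E \<subseteq> arcs K" "\<And>a. a \<in> arcs K \<Longrightarrow> card {e \<in> E. \<pi> e = a} = t"
    "\<And>Y. Y \<subseteq> E \<Longrightarrow> insert x Y \<in> indeps M \<longleftrightarrow> inj_on \<pi> Y \<and> \<not> (\<exists>C\<in>cycles K. C \<subseteq> \<pi> ` Y)"
proof -
  have KM: "ground (cycle_matroid K) = arcs K"
    "indeps (cycle_matroid K) = {I. I \<subseteq> arcs K \<and> \<not> (\<exists>C\<in>cycles K. C \<subseteq> I)}"
    by (simp_all add: cycle_matroid_def matroid_of_circuits_def)
  obtain h where h: "bij_betw h (rep ` E) (arcs K)"
    and h_indep: "\<And>X. X \<subseteq> rep ` E \<Longrightarrow> insert x X \<in> indeps M \<longleftrightarrow> h ` X \<in> indeps (cycle_matroid K)"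
    using iso si_indeps unfolding matroid_iso_def si_ground KM(1) by metis
  have inj: "inj_on h (rep ` E)" and img: "h ` rep ` E = arcs K" using h by (auto simp: bij_betw_def)
  define \<pi> where "\<pi> = h \<circ> rep"
  show thesis
  proof
    show "\<pi> ` E \<subseteq> arcs K" using img by (auto simp: \<pi>_def)
    show "card {e \<in> E. \<pi> e = a} = t" if "a \<in> arcs K" for a
    proof -
      have "a \<in> h ` rep ` E" using img that by simp
      then obtain s where s: "s \<in> E" "h (rep s) = a" by blast
      have "{e \<in> E. \<pi> e = a} = R `` {s}"
      proof -
        have "\<pi> e = a \<longleftrightarrow> (s, e) \<in> R" if "e \<in> E" for e
          using s that inj rep_eq_iff[OF s(1) that] by (auto simp: \<pi>_def inj_on_eq_iff)
        then show ?thesis by (auto simp: parallel_rel_eq)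
      qed
      moreover have "R `` {s} \<in> parallel_classes (contraction M {x})"
        unfolding parallel_classes_def no_loops using s(1) by (simp add: quotientI)
      ultimately show ?thesis using card by simp
    qed
    show "insert x Y \<in> indeps M \<longleftrightarrow> inj_on \<pi> Y \<and> \<not> (\<exists>C\<in>cycles K. C \<subseteq> \<pi> ` Y)" if Y: "Y \<subseteq> E" for Y
    proof -
      have sub: "rep ` Y \<subseteq> rep ` E" using Y by auto
      have "inj_on \<pi> Y \<longleftrightarrow> inj_on rep Y"
        unfolding \<pi>_def using inj_on_subset[OF inj sub] by (metis comp_inj_on inj_on_imageI2)
      moreover have "h ` rep ` Y = \<pi> ` Y" by (auto simp: \<pi>_def)
      moreover have "\<pi> ` Y \<subseteq> arcs K" using img Y by (auto simp: \<pi>_def)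
      ultimately show ?thesis using indep_rep_iff[OF Y] h_indep[OF sub] by (simp add: KM(2))
    qed
  qed
qed

end

section \<open>Triangles of a matroid lying over a complete graph\<close>

locale clique_lift = simple_contraction M x for M :: "'a indep_structure" and x :: 'a +
  fixes n t :: nat and \<pi> :: "'a \<Rightarrow> nat \<times> nat"
  assumes n: "4 \<le> n" and t: "2 \<le> t"
    and \<pi>_arcs: "\<pi> ` E \<subseteq> arcs (complete_graph n)"
    and \<pi>_card: "a \<in> arcs (complete_graph n) \<Longrightarrow> card {e \<in> E. \<pi> e = a} = t"
    and forest: "Y \<subseteq> E \<Longrightarrow>
      insert x Y \<in> indeps M \<longleftrightarrow> inj_on \<pi> Y \<and> \<not> (\<exists>C\<in>cycles (complete_graph n). C \<subseteq> \<pi> ` Y)"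
    and no_long_line: "\<not> (\<exists>e\<in>ground M. has_restriction (contraction M {e}) (uniform 2 (t + 2)))"
begin

abbreviation K where "K \<equiv> complete_graph n"

sublocale K: wf_digraph K
  by (rule wf_complete_graph)

text \<open>Symmetric in its indices, because triangles are used from all their vertices while the
  arcs of the complete graph are increasing pairs.\<close>

definition P :: "nat \<Rightarrow> nat \<Rightarrow> 'a set" where
  "P u v = {e \<in> E. \<pi> e = (min u v, max u v)}"

lemma P_sym: "P u v = P v u"
  by (simp add: P_def min.commute max.commute)

lemma P_E: "a \<in> P u v \<Longrightarrow> a \<in> E"
  by (simp add: P_def)

lemma P_ground: "a \<in> P u v \<Longrightarrow> a \<in> ground M"
  by (simp add: P_def)

lemma P_card: "u < n \<Longrightarrow> v < n \<Longrightarrow> u \<noteq> v \<Longrightarrow> card (P u v) = t"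
  unfolding P_def by (rule \<pi>_card) (auto simp: min_def max_def)

lemma P_ends: "a \<in> P u v \<Longrightarrow> {tail K (\<pi> a), head K (\<pi> a)} = {u, v}"
  by (auto simp: P_def min_def max_def)

lemma P_disjoint: "a \<in> P u v \<Longrightarrow> a \<in> P u' v' \<Longrightarrow> {u, v} = {u', v'}"
  using P_ends by metis

lemma star_indep:
  assumes "Y \<subseteq> E" "inj_on \<pi> Y" "\<And>e. e \<in> Y \<Longrightarrow> u \<in> {tail K (\<pi> e), head K (\<pi> e)}"
  shows "insert x Y \<in> indeps M"
proof -
  have sub: "\<pi> ` Y \<subseteq> arcs K" using assms(1) \<pi>_arcs by blast
  have lt: "tail K a < head K a" if "a \<in> \<pi> ` Y" for a
    using that sub by (cases a) auto
  have "\<not> (\<exists>C\<in>cycles K. C \<subseteq> \<pi> ` Y)"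
  proof (rule K.star_acyclic[OF sub])
    show "tail K a \<noteq> head K a" if "a \<in> \<pi> ` Y" for a using lt[OF that] by simp
    show "u \<in> {tail K a, head K a}" if "a \<in> \<pi> ` Y" for a using that assms(3) by blast
    show "a = b" if "a \<in> \<pi> ` Y" "b \<in> \<pi> ` Y" "{tail K a, head K a} = {tail K b, head K b}" for a b
      using lt[OF that(1)] lt[OF that(2)] that(3) by (auto simp: doubleton_eq_iff prod_eq_iff)
  qed
  then show ?thesis using forest assms by blast
qed

lemma star_three_indep:
  assumes "distinct [u, v, w, z]" "a \<in> P u v" "b \<in> P u w" "c \<in> P u z"
  shows "{x, a, b, c} \<in> indeps M"
proof (rule star_indep[of "{a, b, c}" u])
  show "{a, b, c} \<subseteq> E" using assms P_E by blast
  have "\<pi> a \<noteq> \<pi> b" "\<pi> a \<noteq> \<pi> c" "\<pi> b \<noteq> \<pi> c"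
    using P_ends[OF assms(2)] P_ends[OF assms(3)] P_ends[OF assms(4)] assms(1)
    by (metis distinct_length_2_or_more doubleton_eq_iff)+
  then show "inj_on \<pi> {a, b, c}" by auto
  show "u \<in> {tail K (\<pi> e), head K (\<pi> e)}" if "e \<in> {a, b, c}" for e
    using that P_ends[OF assms(2)] P_ends[OF assms(3)] P_ends[OF assms(4)] by blast
qed

lemma star_two_indep:
  assumes "distinct [u, v, w]" "a \<in> P u v" "b \<in> P u w"
  shows "{x, a, b} \<in> indeps M"
proof (rule star_indep[of "{a, b}" u])
  show "{a, b} \<subseteq> E" using assms P_E by blast
  have "\<pi> a \<noteq> \<pi> b"
    using P_ends[OF assms(2)] P_ends[OF assms(3)] assms(1)
    by (metis distinct_length_2_or_more doubleton_eq_iff)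
  then show "inj_on \<pi> {a, b}" by auto
  show "u \<in> {tail K (\<pi> e), head K (\<pi> e)}" if "e \<in> {a, b}" for e
    using that P_ends[OF assms(2)] P_ends[OF assms(3)] by blast
qed

lemma same_class_dep:
  assumes "a \<in> P u v" "b \<in> P u v" "a \<noteq> b"
  shows "{x, a, b} \<notin> indeps M"
  using forest[of "{a, b}"] assms by (auto simp: P_def)

lemma triangle_dep:
  assumes "distinct [u, v, w]" "a \<in> P u v" "b \<in> P v w" "c \<in> P u w"
  shows "{x, a, b, c} \<notin> indeps M"
proof -
  note ends = P_ends[OF assms(2)] P_ends[OF assms(3)] P_ends[OF assms(4)]
  let ?Y = "{\<pi> a, \<pi> b, \<pi> c}"
  have E: "{a, b, c} \<subseteq> E" using assms P_E by blast
  then have sub: "?Y \<subseteq> arcs K" using \<pi>_arcs by blast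
  have ne: "\<pi> b \<noteq> \<pi> a" "\<pi> c \<noteq> \<pi> a"
    using ends assms(1) by (metis distinct_length_2_or_more doubleton_eq_iff)+
  have edge: "joined K (?Y - {\<pi> a}) y z"
    if "e \<in> {\<pi> b, \<pi> c}" "{tail K e, head K e} = {y, z}" for e y z
    using that joined_edge[of e "?Y - {\<pi> a}" K] joined_sym[of K "?Y - {\<pi> a}" "tail K e" "head K e"] ne
    by (metis (no_types, lifting) DiffI doubleton_eq_iff insertCI insertE singletonD)
  have "joined K (?Y - {\<pi> a}) v w" "joined K (?Y - {\<pi> a}) w u"
    using edge[of "\<pi> b" v w] edge[of "\<pi> c" w u] ends by (simp_all add: insert_commute)
  then have vu: "joined K (?Y - {\<pi> a}) v u" by (rule joined_trans)
  then have "joined K (?Y - {\<pi> a}) (tail K (\<pi> a)) (head K (\<pi> a))"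
    using joined_sym[OF vu] ends(1) by (metis doubleton_eq_iff)
  then have "\<exists>C\<in>cycles K. C \<subseteq> ?Y" using K.has_cycle_iff[OF sub] by blast
  then show ?thesis using forest[OF E] by simp
qed

lemma triangle_cl:
  assumes "distinct [u, v, w]" "a \<in> P u v" "b \<in> P v w" "c \<in> P u w"
  shows "c \<in> cl {x, a, b}"
proof (rule clI[OF _ order_refl])
  show "{x, a, b} \<in> indeps M"
    using star_two_indep[of v u w a b] assms P_sym[of u v] by simp
  show "insert c {x, a, b} \<notin> indeps M" using triangle_dep[OF assms] by (simp add: insert_commute)
  show "c \<in> ground M" using P_ground[OF assms(4)] .
qed

lemma same_class_cl:
  assumes "a \<in> P u v" "b \<in> P u v" "a \<noteq> b"
  shows "x \<in> cl {a, b}" "b \<in> cl {x, a}"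
proof -
  have g: "a \<in> ground M" "b \<in> ground M" using assms P_ground by blast+
  show "x \<in> cl {a, b}"
    using clI[OF pair_indep[OF g] order_refl x] same_class_dep[OF assms] by simp
  show "b \<in> cl {x, a}"
    using clI[OF pair_indep[OF x g(1)] order_refl g(2)] same_class_dep[OF assms]
    by (simp add: insert_commute)
qed

lemma completion_exists:
  assumes "distinct [u, v, w]" "{u, v, w} \<subseteq> {..<n}" "a \<in> P u v" "b \<in> P v w"
  shows "\<exists>c\<in>P u w. {a, b, c} \<notin> indeps M"
proof (rule ccontr)
  assume "\<not> ?thesis"
  then have no: "{a, b, c} \<in> indeps M" if "c \<in> P u w" for c using that by blast
  let ?X = "insert x (insert b (P u w))"
  have g: "a \<in> ground M" "b \<in> ground M" "\<And>c. c \<in> P u w \<Longrightarrow> c \<in> ground M"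
    using assms P_ground by blast+
  have ne: "a \<noteq> x" "b \<noteq> x" "x \<notin> P u w" using assms P_E by blast+
  have "b \<notin> P u w" "a \<notin> P u w" "a \<noteq> b"
    using P_disjoint[of b u w v w] P_disjoint[of a u w u v] P_disjoint[of a v w u v] assms
    by (auto simp: doubleton_eq_iff)
  have card_P: "card (P u w) = t" using P_card assms by simp
  then have "finite (P u w)" using t card.infinite by fastforce
  then have X: "finite ?X" "card ?X = t + 2" using card_P ne \<open>b \<notin> P u w\<close> by simp_all
  have X_ground: "?X \<subseteq> ground (contraction M {a})"
    using g x ne \<open>a \<notin> P u w\<close> \<open>a \<noteq> b\<close> by auto
  have xab: "{x, a, b} \<in> indeps M"
    using star_two_indep[of v u w a b] assms P_sym[of u v] by simp
  have xac: "{x, a, c} \<in> indeps M" if "c \<in> P u w" for c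
    using star_two_indep[of u v w a c] assms that by simp
  \<comment> \<open>Two elements of one class lie on a line through \<open>x\<close>, and
    \<open>a\<close> is off that line.\<close>
  have acc: "{a, c, c'} \<in> indeps M" if c: "c \<in> P u w" "c' \<in> P u w" for c c'
  proof (cases "c = c'")
    case True
    then show ?thesis using pair_indep g c by simp
  next
    case False
    have xc: "{x, c} \<in> indeps M" using pair_indep x g(3)[OF c(1)] .
    have "{c, c'} \<subseteq> cl {x, c}"
      using same_class_cl(2)[OF c False] subset_cl[OF indep_ground[OF xc]] by simp
    moreover have "insert a {x, c} \<in> indeps M" using xac[OF c(1)] by (simp add: insert_commute)
    moreover have "a \<notin> {x, c}" using ne c(1) \<open>a \<notin> P u w\<close> by auto
    ultimately have "a \<notin> cl {c, c'}" using not_in_cl[OF xc] by blast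
    then show ?thesis
      by (rule insert_indep[OF pair_indep[OF g(3)[OF c(1)] g(3)[OF c(2)]] g(1)])
  qed
  \<comment> \<open>The case \<open>y = z\<close> is included in order to cover one-element
    sets.\<close>
  have triple: "{a, y, z} \<in> indeps M" if "y \<in> ?X" "z \<in> ?X" for y z
  proof -
    have ax: "{a, x} \<in> indeps M" "{a, b} \<in> indeps M" using pair_indep g x by auto
    have xb: "{a, x, b} \<in> indeps M" "{a, b, x} \<in> indeps M"
      using xab by (simp_all add: insert_commute)
    have c: "{a, x, c} \<in> indeps M" "{a, c, x} \<in> indeps M" "{a, b, c} \<in> indeps M" "{a, c, b} \<in> indeps M"
      if "c \<in> P u w" for c
      using xac[OF that] no[OF that] by (simp_all add: insert_commute)
    consider "y = x" | "y = b" | "y \<in> P u w" using \<open>y \<in> ?X\<close> by blast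
    then show ?thesis using \<open>z \<in> ?X\<close> ax xb c acc by cases auto
  qed
  have indep_iff: "Y \<in> indeps (restriction (contraction M {a}) ?X) \<longleftrightarrow> card Y \<le> 2" if Y: "Y \<subseteq> ?X" for Y
  proof -
    have "finite Y" by (rule finite_subset[OF Y X(1)])
    have "insert a Y \<in> indeps M \<longleftrightarrow> card Y \<le> 2"
    proof
      assume indep: "insert a Y \<in> indeps M"
      have sub: "{x, a, b} \<subseteq> ground M" using x g by simp
      \<comment> \<open>Each element of \<open>P u w\<close> closes a triangle with \<open>a\<close>
        and \<open>b\<close>, so everything lies in one plane, which becomes a line on contracting
        \<open>a\<close>.\<close>
      have "insert a ?X \<subseteq> cl {x, a, b}"
        using subset_cl[OF sub] triangle_cl[OF assms(1,3,4)] by auto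
      then have "insert a Y \<subseteq> cl {x, a, b}" using Y by blast
      then have "card (insert a Y) \<le> card {x, a, b}"
        using dependent_in_cl[OF sub] indep by (meson not_le)
      also have "\<dots> \<le> 3" by (simp add: card_insert_if)
      finally show "card Y \<le> 2"
        using X_ground Y \<open>finite Y\<close> by (simp add: card_insert_if split: if_splits) blast
    next
      assume "card Y \<le> 2"
      then consider "Y = {}" | y where "Y = {y}" | y z where "Y = {y, z}"
        using \<open>finite Y\<close> by (metis One_nat_def Suc_1 card_0_eq card_1_singletonE card_2_iff le_SucE le_zero_eq)
      then show "insert a Y \<in> indeps M"
      proof cases
        case 1
        then show ?thesis using pair_indep[OF g(1) g(1)] by simp
      next
        case (2 y)
        then show ?thesis using triple[of y y] Y by simp
      next
        case (3 y z)
        then show ?thesis using triple[of y z] Y by simp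
      qed
    qed
    then show ?thesis using Y X_ground contraction_indep[OF g(1), of Y] by (auto simp: restriction_def)
  qed
  obtain f where f: "bij_betw f ?X {..<t + 2}"
    using finite_same_card_bij[OF X(1), of "{..<t + 2}"] X(2) by auto
  have "matroid_iso (restriction (contraction M {a}) ?X) (uniform 2 (t + 2))"
    unfolding matroid_iso_def
  proof (intro exI conjI allI impI)
    have ground: "ground (restriction (contraction M {a}) ?X) = ?X"
      using X_ground by (auto simp: restriction_def)
    show "bij_betw f (ground (restriction (contraction M {a}) ?X)) (ground (uniform 2 (t + 2)))"
      using f unfolding ground by (simp add: uniform_def)
    show "Y \<in> indeps (restriction (contraction M {a}) ?X) \<longleftrightarrow> f ` Y \<in> indeps (uniform 2 (t + 2))"
      if "Y \<subseteq> ground (restriction (contraction M {a}) ?X)" for Y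
    proof -
      have Y: "Y \<subseteq> ?X" using that ground by simp
      have "inj_on f ?X" and img: "f ` ?X = {..<t + 2}" using f unfolding bij_betw_def by simp_all
      then have "card (f ` Y) = card Y" by (intro card_image inj_on_subset[OF _ Y])
      moreover have "f ` Y \<subseteq> {..<t + 2}" using image_mono[OF Y, of f] unfolding img .
      ultimately
      show ?thesis using indep_iff[OF Y] by (simp add: uniform_def)
    qed
  qed
  moreover have "?X \<subseteq> ground (contraction M {a})" by (rule X_ground)
  ultimately have "has_restriction (contraction M {a}) (uniform 2 (t + 2))"
    unfolding has_restriction_def by (intro exI[of _ ?X] conjI)
  then show False using no_long_line g(1) by (meson bexI)
qed

lemma dependent_triple_cl:
  assumes "{a, b} \<in> indeps M" "{a, b, c} \<notin> indeps M" "c \<in> ground M"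
  shows "c \<in> cl {a, b}"
  using clI[OF assms(1) order_refl assms(3)] assms(2) by (simp add: insert_commute)

text \<open>Two completions would put two elements of one class, and hence \<open>x\<close>, on the
  line of \<open>a\<close> and \<open>b\<close>.\<close>

lemma completion_unique:
  assumes "distinct [u, v, w]" "a \<in> P u v" "b \<in> P v w"
    and "c \<in> P u w" "{a, b, c} \<notin> indeps M" "c' \<in> P u w" "{a, b, c'} \<notin> indeps M"
  shows "c = c'"
proof (rule ccontr)
  assume "c \<noteq> c'"
  have g: "a \<in> ground M" "b \<in> ground M" "c \<in> ground M" "c' \<in> ground M"
    using assms P_ground by blast+
  have ab: "{a, b} \<in> indeps M" using pair_indep g by simp
  have "{c, c'} \<subseteq> cl {a, b}" using dependent_triple_cl[OF ab] assms g by simp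
  then have "x \<in> cl {a, b}"
    using in_cl_trans[OF same_class_cl(1)[OF assms(4,6) \<open>c \<noteq> c'\<close>]] indep_ground[OF ab] by blast
  moreover have "{x, a, b} \<in> indeps M"
    using star_two_indep[of v u w a b] assms P_sym[of u v] by simp
  moreover have "x \<notin> {a, b}" using assms P_E by blast
  ultimately show False using indep_insertD by blast
qed

text \<open>The star at \<open>u\<close> lies over a forest, so its span misses \<open>x\<close>.
  That span contains the fourth triangle, which would span \<open>x\<close> if it were
  independent.\<close>

lemma fourth_triangle:
  assumes "distinct [u, v, w, z]"
    and "a \<in> P u v" "b \<in> P u w" "c \<in> P u z" "d \<in> P v w" "e \<in> P v z" "f \<in> P w z"
    and "{a, b, d} \<notin> indeps M" "{a, c, e} \<notin> indeps M" "{b, c, f} \<notin> indeps M"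
  shows "{d, e, f} \<notin> indeps M"
proof
  assume def: "{d, e, f} \<in> indeps M"
  have g: "a \<in> ground M" "b \<in> ground M" "c \<in> ground M" "d \<in> ground M" "e \<in> ground M" "f \<in> ground M"
    using assms P_ground by blast+
  have abc: "{x, a, b, c} \<in> indeps M" using star_three_indep assms by blast
  have "x \<notin> {a, b, c}" using assms P_E by blast
  then have "x \<notin> cl {a, b, c}" using indep_insertD abc by blast
  have "d \<in> cl {a, b}" "e \<in> cl {a, c}" "f \<in> cl {b, c}"
    using dependent_triple_cl pair_indep g assms(8-10) by simp_all
  then have "{d, e, f} \<subseteq> cl {a, b, c}"
    using cl_mono[of "{a, b}" "{a, b, c}"] cl_mono[of "{a, c}" "{a, b, c}"]
      cl_mono[of "{b, c}" "{a, b, c}"] by auto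
  moreover have "{x, d, f, e} \<notin> indeps M" using triangle_dep[of v w z d f e] assms by simp
  then have "x \<in> cl {d, e, f}"
    using clI[OF def order_refl x] by (simp add: insert_commute)
  ultimately have "x \<in> cl {a, b, c}" using in_cl_trans[of x "{d, e, f}" "{a, b, c}"] g by simp
  then show False using \<open>x \<notin> cl {a, b, c}\<close> by blast
qed

sublocale triangles: triangle_system P "\<lambda>X. X \<notin> indeps M" n t
proof
  show "4 \<le> n" "0 < t" "P u v = P v u" for u v using n t P_sym by auto
  show "card (P u v) = t" if "u < n" "v < n" "u \<noteq> v" for u v using P_card that .
  show "\<exists>!c. c \<in> P u w \<and> {a, b, c} \<notin> indeps M"
    if "distinct [u, v, w]" "{u, v, w} \<subseteq> {..<n}" "a \<in> P u v" "b \<in> P v w" for u v w a b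
    using completion_exists[OF that] completion_unique[OF that(1,3,4)] by blast
  show "{d, e, f} \<notin> indeps M"
    if "distinct [u, v, w, z]" "{u, v, w, z} \<subseteq> {..<n}" "a \<in> P u v" "b \<in> P u w" "c \<in> P u z"
      "d \<in> P v w" "e \<in> P v z" "f \<in> P w z"
      "{a, b, d} \<notin> indeps M" "{a, c, e} \<notin> indeps M" "{b, c, f} \<notin> indeps M"
    for u v w z a b c d e f
    using fourth_triangle[OF that(1,3-)] .
qed

theorem iso_LG_plus:
  "\<exists>(\<Gamma> :: nat monoid) N. group \<Gamma> \<and> finite (carrier \<Gamma>) \<and> order \<Gamma> \<ge> 2 \<and>
    is_LG_plus n \<Gamma> N \<and> matroid_iso M N"
proof (rule triangles.coordinatization)
  fix \<Gamma> :: "nat monoid" and \<Lambda>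
  assume \<Gamma>: "group \<Gamma>" "carrier \<Gamma> = {..<t}"
    and \<Lambda>_bij: "\<And>u v. u < v \<Longrightarrow> v < n \<Longrightarrow> bij_betw (\<Lambda> u v) {..<t} (P u v)"
    and \<Lambda>_triangle: "\<And>i j l g h. i < j \<Longrightarrow> j < l \<Longrightarrow> l < n \<Longrightarrow> g < t \<Longrightarrow> h < t \<Longrightarrow>
      {\<Lambda> i j g, \<Lambda> j l h, \<Lambda> i l (g \<otimes>\<^bsub>\<Gamma>\<^esub> h)} \<notin> indeps M"
  let ?G = "LG_graph n \<Gamma>"
  \<comment> \<open>Equal end vertices keep this triple from being an edge.\<close>
  define e0 :: "nat \<times> nat \<times> nat" where "e0 = (0, 0, 0)"
  define \<psi> where "\<psi> e = (if e = e0 then x else case e of (i, j, g) \<Rightarrow> \<Lambda> i j g)" for e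
  have \<psi>_e0: "\<psi> e0 = x" by (simp add: \<psi>_def)
  have e0: "e0 \<notin> arcs ?G" by (simp add: e0_def)
  have \<psi>_arc: "\<psi> (i, j, g) = \<Lambda> i j g" if "i < j" for i j g using that by (simp add: \<psi>_def e0_def)
  have \<Lambda>_mem: "\<Lambda> i j g \<in> P i j" if "i < j" "j < n" "g < t" for i j g
    using \<Lambda>_bij[OF that(1,2)] that(3) by (auto simp: bij_betw_def)
  have \<psi>_P: "\<psi> e \<in> E \<and> \<pi> (\<psi> e) = edge_ends e" if "e \<in> arcs ?G" for e
  proof -
    obtain i j g where e: "e = (i, j, g)" "i < j" "j < n" "g < t" using \<open>e \<in> arcs ?G\<close> \<Gamma>(2) by auto
    then show ?thesis using \<Lambda>_mem[of i j g] by (simp add: \<psi>_arc edge_ends_def P_def)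
  qed
  have inj: "inj_on \<psi> (arcs ?G)"
  proof (rule inj_onI)
    fix e f assume ef: "e \<in> arcs ?G" "f \<in> arcs ?G" and eq: "\<psi> e = \<psi> f"
    have "edge_ends e = edge_ends f" using \<psi>_P[OF ef(1)] \<psi>_P[OF ef(2)] eq by simp
    moreover obtain i j g where e: "e = (i, j, g)" "i < j" "j < n" "g < t" using ef(1) \<Gamma>(2) by auto
    moreover obtain i' j' h where f: "f = (i', j', h)" "h < t" using ef(2) \<Gamma>(2) by auto
    ultimately have "i = i'" "j = j'" by (simp_all add: edge_ends_def)
    then show "e = f"
      using e f eq \<Lambda>_bij[of i j] by (auto simp: \<psi>_arc bij_betw_def dest: inj_onD)
  qed
  have surj: "\<psi> ` arcs ?G = E"
  proof
    show "\<psi> ` arcs ?G \<subseteq> E" using \<psi>_P by blast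
    show "E \<subseteq> \<psi> ` arcs ?G"
    proof
      fix e assume e: "e \<in> E"
      then obtain i j where ij: "\<pi> e = (i, j)" "i < j" "j < n" using \<pi>_arcs by auto
      then have "e \<in> P i j" using e by (simp add: P_def)
      then obtain g where "g < t" "e = \<Lambda> i j g" using \<Lambda>_bij[OF ij(2,3)] by (auto simp: bij_betw_def)
      then have "\<psi> (i, j, g) = e" "(i, j, g) \<in> arcs ?G" using ij \<Gamma>(2) by (auto simp: \<psi>_arc)
      then show "e \<in> \<psi> ` arcs ?G" by blast
    qed
  qed
  have bij: "bij_betw \<psi> (insert e0 (arcs ?G)) (ground M)"
    unfolding bij_betw_def
  proof
    show "inj_on \<psi> (insert e0 (arcs ?G))" using inj surj \<psi>_e0 by auto
    show "\<psi> ` insert e0 (arcs ?G) = ground M" using surj \<psi>_e0 x by auto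
  qed
  define N where "N = \<lparr>ground = insert e0 (arcs ?G),
    indeps = {X. X \<subseteq> insert e0 (arcs ?G) \<and> \<psi> ` X \<in> indeps M}\<rparr>"
  note N = transport[OF bij N_def]
  interpret N: lift_labelling N \<Gamma> n e0
  proof (intro lift_labelling.intro lift_labelling_axioms.intro N(1) \<Gamma>(1) e0)
    show "ground N = insert e0 (arcs ?G)" by (simp add: N_def)
    show "insert e0 Y \<in> indeps N \<longleftrightarrow> \<not> (\<exists>C\<in>cycles ?G. C \<subseteq> Y)" if Y: "Y \<subseteq> arcs ?G" for Y
    proof -
      have "\<psi> ` Y \<subseteq> E" using Y surj by blast
      have "edge_ends ` Y = \<pi> ` \<psi> ` Y" using Y \<psi>_P by (force simp: image_iff)
      moreover have "inj_on edge_ends Y \<longleftrightarrow> inj_on (\<pi> \<circ> \<psi>) Y"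
        by (rule inj_on_cong) (use Y \<psi>_P in auto)
      then have "inj_on edge_ends Y \<longleftrightarrow> inj_on \<pi> (\<psi> ` Y)"
        using comp_inj_on_iff[OF inj_on_subset[OF inj Y]] by blast
      moreover have "insert e0 Y \<in> indeps N \<longleftrightarrow> insert x (\<psi> ` Y) \<in> indeps M"
        using Y \<psi>_e0 by (auto simp: N_def)
      \<comment> \<open>Parallel edges of the multigraph correspond to a failure of injectivity of
        \<open>\<pi>\<close>.\<close>
      ultimately show ?thesis
        using forest[OF \<open>\<psi> ` Y \<subseteq> E\<close>] LG_graph_has_cycle_iff[OF Y] by simp
    qed
    show "{(i, j, g), (i, j, h)} \<in> indeps N"
      if "i < j" "j < n" "g \<in> carrier \<Gamma>" "h \<in> carrier \<Gamma>" for i j g h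
    proof -
      have "\<Lambda> i j g \<in> ground M" "\<Lambda> i j h \<in> ground M"
        using P_ground[OF \<Lambda>_mem] that \<Gamma>(2) by blast+
      then show ?thesis using pair_indep that by (simp add: N_def \<psi>_arc)
    qed
    show "{(i, j, g), (j, l, h), (i, l, g \<otimes>\<^bsub>\<Gamma>\<^esub> h)} \<notin> indeps N"
      if "i < j" "j < l" "l < n" "g \<in> carrier \<Gamma>" "h \<in> carrier \<Gamma>" for i j l g h
    proof -
      have "i < l" using that by simp
      then show ?thesis using that \<Gamma>(2) \<Lambda>_triangle[of i j l g h] by (simp add: N_def \<psi>_arc)
    qed
  qed
  show ?thesis
    using \<Gamma> t N.is_LG_plus N(2) unfolding order_def
    by (intro exI[of _ \<Gamma>] exI[of _ N] conjI) simp_all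
qed

end

theorem theorem4p6:
  fixes M :: "'a indep_structure" and x :: 'a and n t :: nat
  assumes "simple_matroid M"
    and "x \<in> ground M"
    and "n \<ge> 4"
    and "matroid_iso (si (contraction M {x})) (cycle_matroid (complete_graph n))"
    and "t \<ge> 2"
    and "\<forall>P\<in>parallel_classes (contraction M {x}). card P = t"
    and "\<not> (\<exists>e\<in>ground M. has_restriction (contraction M {e}) (uniform 2 (t + 2)))"
  shows "\<exists>(\<Gamma> :: nat monoid) N. group \<Gamma> \<and> finite (carrier \<Gamma>) \<and> order \<Gamma> \<ge> 2 \<and>
    is_LG_plus n \<Gamma> N \<and> matroid_iso M N"
proof -
  have "matroid M" using assms(1) by (simp add: simple_matroid_def)
  then interpret simple_contraction M x
    by (rule simple_contraction.intro[OF _ simple_contraction_axioms.intro[OF assms(1,2)]])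
  show ?thesis
  proof (rule projection[OF assms(4,6)])
    fix \<pi>
    assume \<pi>: "\<pi> ` E \<subseteq> arcs (complete_graph n)"
      "\<And>a. a \<in> arcs (complete_graph n) \<Longrightarrow> card {e \<in> E. \<pi> e = a} = t"
      "\<And>Y. Y \<subseteq> E \<Longrightarrow>
        insert x Y \<in> indeps M \<longleftrightarrow> inj_on \<pi> Y \<and> \<not> (\<exists>C\<in>cycles (complete_graph n). C \<subseteq> \<pi> ` Y)"
    interpret clique_lift M x n t \<pi>
      by (rule clique_lift.intro[OF simple_contraction_axioms
          clique_lift_axioms.intro[OF assms(3,5) \<pi> assms(7)]])
    show ?thesis by (rule iso_LG_plus)
  qed
qed

end
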